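(* Let $g\ge 1$ and $n\ge 0$ be integers. Let $TM^b_{g,n}$, its subspace $TM^e_{g,n}\subseteq TM^b_{g,n}$, and the function $\Phi:TM^b_{g,n}\times[0,1]\to TM^b_{g,n}$ be as defined in the context. Then $\Phi$ is a strong deformation retraction from $TM^b_{g,n}$ to $TM^e_{g,n}$; that is, $\Phi$ is continuous, $\Phi(x,0)=x$ and $\Phi(x,1)\in TM^e_{g,n}$ for all $x\in TM^b_{g,n}$, and $\Phi(y,t)=y$ for all $y\in TM^e_{g,n}$, $t\in[0,1]$.
   Context: Graphs are finite, undirected and connected; loops and multiple edges are allowed. $E(G)$ is the edge set, and the genus of $G$ is $|E(G)|-|V(G)|+1$. $\Delta(G)$ is the topological realization of $G$ as a 1-dimensional CW complex, each edge being parametrized by $[0,1]$. A graph is stable if it has no bridges and no vertex of valency $2$ unless that vertex is adjacent to a loop. $[n]=\{1,\dots,n\}$. The space $TM^b_{g,n}$: its points are represented by triples $(G,l_G,p_G)$ where $G$ is a stable graph of genus $g$, $l_G:E(G)\to(0,\infty)$ is a length function, and $p_G:[n]\to\Delta(G)$ is an arbitrary function (marking); two triples represent the same point if there is an isometry of the corresponding metric realizations of the graphs carrying one marking to the other. Topology: for each stable graph $G$ of genus $g$ let $L(G)$ be the set of $l:E(G)\to[0,\infty)$ such that the edges with $l=0$ form a forest (contain no cycle); the map $\coprod_G L(G)\times\Delta(G)^n\to TM^b_{g,n}$ sending $(l,p)$ to the class of the marked metric graph obtained by contracting all edges of length $0$ (a marked point at relative position $s$ in an edge $e$ of positive length sits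 at distance $s\,l(e)$ from the corresponding end) is surjective, and $TM^b_{g,n}$ carries the quotient topology (so points near a given point are obtained by slightly changing edge lengths, slightly moving the marked points, and replacing vertices by trees of short edges). Associated ordered partition: for a metric graph $(G,l_G)$ let $\pi(G)=(E_1,\dots,E_m)$ be the ordered partition of $E(G)$ into nonempty blocks such that all edges in $E_i$ have the same length $l_i$ and $0<l_1<\dots<l_m$. The metric graph is filtered by forests if $E_1\cup\dots\cup E_{m-1}$ induces a forest (no cycles); for $m=1$ this is considered satisfied. $TM^e_{g,n}$ is the subspace of $TM^b_{g,n}$ of points whose representing metric graphs are filtered by forests. The function $\Phi$: let $x$ be represented by $(G,l_G,p_G)$ with $\pi(G)=(E_1,\dots,E_m)$ and lengths $l_1<\dots<l_m$. Let $k$ be the maximal index such that $E_1\cup\dots\cup E_k$ induces a graph without cycles ($k=0$ if $E_1$ already contains a cycle). For $t\in[0,1]$, $\Phi(x,t)$ is represented by $(G,l_G^t,p_G^t)$, where all edges of $E_i$ have length $$l_i^t=l_i+t(l_m-l_i)\ \text{ for } k+1\le i\le m,\qquad l_i^t=l_i\bigl(1+t(l_m/l_{k+1}-1)\bigr)\ \text{ for } 1\le i\le k,$$ and $p_G^t(j)=p_G(j)$ if $p_G(j)$ is a vertex, while if $p_G(j)$ is an interior point of an edge $e$ then $p_G^t(j)$ lies on the same edge $e$ at the same position relative to the length $l_G^t(e)$. *)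

theory Defs
  imports "HOL-Analysis.Analysis" "Graph_Theory.Digraph_Component"
begin

text \<open>
  An undirected multigraph, loops allowed, is encoded by a digraph: each edge carries an arbitrary
  orientation, which serves only to parametrize it by \<open>[0,1]\<close> from its tail to its head.
  Vertices and edges are labelled by natural numbers, which covers every finite graph up to
  isomorphism. Replacing one labelled and oriented copy of a graph by another does not change the
  marked metric graphs it represents up to isometry, so the redundant copies affect neither the set
  of points nor the quotient topology of the moduli space.
\<close>

type_synonym graph = "(nat, nat) pre_digraph"


subsection \<open>Stable graphs\<close>

definition genus :: "('v, 'e) pre_digraph \<Rightarrow> int" where
  "genus G = int (card (arcs G)) - int (card (verts G)) + 1"

text \<open>A loop contributes 2 to the valency.\<close>

definition valency :: "('v, 'e) pre_digraph \<Rightarrow> 'v \<Rightarrow> nat" where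
  "valency G v = in_degree G v + out_degree G v"

text \<open>
  The constant \<open>Digraph_Component.connected\<close> forgets the orientation of the edges.
\<close>

definition bridge :: "('v, 'e) pre_digraph \<Rightarrow> 'e \<Rightarrow> bool" where
  "bridge G e \<longleftrightarrow> e \<in> arcs G \<and> \<not> Digraph_Component.connected (pre_digraph.del_arc G e)"

definition stable :: "('v, 'e) pre_digraph \<Rightarrow> bool" where
  "stable G \<longleftrightarrow>
     fin_digraph G \<and> Digraph_Component.connected G \<and>
     (\<forall>e \<in> arcs G. \<not> bridge G e) \<and>
     (\<forall>v \<in> verts G. valency G v = 2 \<longrightarrow> (\<exists>e \<in> arcs G. tail G e = v \<and> head G e = v))"

definition stable_graphs :: "nat \<Rightarrow> graph set" where
  "stable_graphs g = {G. stable G \<and> genus G = int g}"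


subsection \<open>Cycles and forests\<close>

text \<open>
  In a pair \<open>(e, b)\<close> the flag tells whether \<open>e\<close> is traversed along its orientation. A cycle is a
  nonempty cyclic sequence of distinct edges visiting distinct vertices: a loop is a cycle, and so
  are two parallel edges. (The library's \<open>pre_digraph.cycle\<close> and \<open>forest\<close> are about directed
  cycles.)
\<close>

definition step_source :: "('v, 'e) pre_digraph \<Rightarrow> 'e \<times> bool \<Rightarrow> 'v" where
  "step_source G s = (if snd s then tail G (fst s) else head G (fst s))"

definition step_target :: "('v, 'e) pre_digraph \<Rightarrow> 'e \<times> bool \<Rightarrow> 'v" where
  "step_target G s = (if snd s then head G (fst s) else tail G (fst s))"

definition undirected_cycle :: "('v, 'e) pre_digraph \<Rightarrow> ('e \<times> bool) list \<Rightarrow> bool" where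
  "undirected_cycle G c \<longleftrightarrow>
     c \<noteq> [] \<and> fst ` set c \<subseteq> arcs G \<and>
     distinct (map fst c) \<and> distinct (map (step_source G) c) \<and>
     (\<forall>i < length c. step_target G (c ! i) = step_source G (c ! (Suc i mod length c)))"

definition induces_forest :: "('v, 'e) pre_digraph \<Rightarrow> 'e set \<Rightarrow> bool" where
  "induces_forest G F \<longleftrightarrow> \<not> (\<exists>c. undirected_cycle G c \<and> fst ` set c \<subseteq> F)"


subsection \<open>The topological realization\<close>

text \<open>
  \<open>Interior e s\<close> is the point of the open edge \<open>e\<close> with parameter \<open>s\<close> strictly between 0 and 1.
\<close>

datatype ('v, 'e) point = Vertex 'v | Interior 'e real

definition realization :: "('v, 'e) pre_digraph \<Rightarrow> ('v, 'e) point set" where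
  "realization G = Vertex ` verts G \<union> {Interior e s | e s. e \<in> arcs G \<and> 0 < s \<and> s < 1}"

text \<open>The characteristic map of the edge \<open>e\<close>.\<close>

definition edge_point :: "('v, 'e) pre_digraph \<Rightarrow> 'e \<Rightarrow> real \<Rightarrow> ('v, 'e) point" where
  "edge_point G e s =
     (if s = 0 then Vertex (tail G e) else if s = 1 then Vertex (head G e) else Interior e s)"

text \<open>The CW topology: a set is open iff its preimage under each characteristic map is open.\<close>

definition realization_topology :: "('v, 'e) pre_digraph \<Rightarrow> ('v, 'e) point topology" where
  "realization_topology G = topology (\<lambda>U. U \<subseteq> realization G \<and>
     (\<forall>e \<in> arcs G. openin (top_of_set {0..1}) {s \<in> {0..1}. edge_point G e s \<in> U}))"

lemma istopology_realization:
  "istopology (\<lambda>U. U \<subseteq> realization G \<and>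
     (\<forall>e \<in> arcs G. openin (top_of_set {0..1}) {s \<in> {0..1}. edge_point G e s \<in> U}))"
proof -
  have 1: "{s \<in> {0..1}. edge_point G e s \<in> S \<inter> T} =
      {s \<in> {0..1}. edge_point G e s \<in> S} \<inter> {s \<in> {0..1}. edge_point G e s \<in> T}" for e S T
    by auto
  have 2: "{s \<in> {0..1}. edge_point G e s \<in> \<Union> K} =
      (\<Union>U \<in> K. {s \<in> {0..1}. edge_point G e s \<in> U})" for e K
    by auto
  show ?thesis
    unfolding istopology_def 1 2 by blast
qed

lemma openin_realization_topology:
  "openin (realization_topology G) U \<longleftrightarrow> U \<subseteq> realization G \<and>
     (\<forall>e \<in> arcs G. openin (top_of_set {0..1}) {s \<in> {0..1}. edge_point G e s \<in> U})"
  unfolding realization_topology_def topology_inverse'[OF istopology_realization] ..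

lemma edge_point_in_realization:
  assumes "wf_digraph G" "e \<in> arcs G" "s \<in> {0..1}"
  shows "edge_point G e s \<in> realization G"
  using assms by (auto simp: edge_point_def realization_def wf_digraph_def)

lemma topspace_realization_topology:
  assumes "wf_digraph G"
  shows "topspace (realization_topology G) = realization G"
proof (rule antisym)
  show "topspace (realization_topology G) \<subseteq> realization G"
    by (metis openin_realization_topology openin_topspace)
  have "{s \<in> {0..1}. edge_point G e s \<in> realization G} = {0..1}" if "e \<in> arcs G" for e
    using edge_point_in_realization[OF assms that] by auto
  then have "openin (realization_topology G) (realization G)"
    by (simp add: openin_realization_topology)
  then show "realization G \<subseteq> topspace (realization_topology G)"
    by (rule openin_subset)
qed


subsection \<open>The metric realization\<close>

text \<open>
  \<open>route G l x y r\<close>: there is a piecewise linear path from \<open>x\<close> to \<open>y\<close> of length \<open>r\<close>, where the edge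
  \<open>e\<close> has length \<open>l e\<close>. The distance is the infimum of the lengths of such paths.
\<close>

inductive route ::
  "('v, 'e) pre_digraph \<Rightarrow> ('e \<Rightarrow> real) \<Rightarrow> ('v, 'e) point \<Rightarrow> ('v, 'e) point \<Rightarrow> real \<Rightarrow> bool"
  for G :: "('v, 'e) pre_digraph" and l :: "'e \<Rightarrow> real"
where
  route_stay: "x \<in> realization G \<Longrightarrow> route G l x x 0"
| route_move: "\<lbrakk>e \<in> arcs G; s \<in> {0..1}; s' \<in> {0..1}; route G l (edge_point G e s') y r\<rbrakk>
    \<Longrightarrow> route G l (edge_point G e s) y (l e * \<bar>s - s'\<bar> + r)"

definition realization_dist ::
  "('v, 'e) pre_digraph \<Rightarrow> ('e \<Rightarrow> real) \<Rightarrow> ('v, 'e) point \<Rightarrow> ('v, 'e) point \<Rightarrow> real" where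
  "realization_dist G l x y = Inf {r. route G l x y r}"

definition realization_isometry ::
  "('v, 'e) pre_digraph \<Rightarrow> ('e \<Rightarrow> real) \<Rightarrow> ('w, 'f) pre_digraph \<Rightarrow> ('f \<Rightarrow> real) \<Rightarrow>
   (('v, 'e) point \<Rightarrow> ('w, 'f) point) \<Rightarrow> bool" where
  "realization_isometry G l G' l' f \<longleftrightarrow>
     bij_betw f (realization G) (realization G') \<and>
     (\<forall>x \<in> realization G. \<forall>y \<in> realization G.
        realization_dist G' l' (f x) (f y) = realization_dist G l x y)"


subsection \<open>Marked metric graphs and the set of points of the moduli space\<close>

type_synonym marked_graph = "graph \<times> (nat \<Rightarrow> real) \<times> (nat \<Rightarrow> (nat, nat) point)"

text \<open>
  Length functions and markings are functions on \<open>arcs G\<close> and \<open>{1..n}\<close> only, hence extensional.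
\<close>

definition marked_graphs :: "nat \<Rightarrow> nat \<Rightarrow> marked_graph set" where
  "marked_graphs g n = {(G, l, p).
     G \<in> stable_graphs g \<and> l \<in> PiE (arcs G) (\<lambda>_. {0<..}) \<and> p \<in> PiE {1..n} (\<lambda>_. realization G)}"

definition marked_isometric :: "nat \<Rightarrow> nat \<Rightarrow> (marked_graph \<times> marked_graph) set" where
  "marked_isometric g n = {((G, l, p), (G', l', p')).
     (G, l, p) \<in> marked_graphs g n \<and> (G', l', p') \<in> marked_graphs g n \<and>
     (\<exists>f. realization_isometry G l G' l' f \<and> (\<forall>j \<in> {1..n}. f (p j) = p' j))}"

definition TMb :: "nat \<Rightarrow> nat \<Rightarrow> marked_graph set set" where
  "TMb g n = marked_graphs g n // marked_isometric g n"


subsection \<open>The topology of the moduli space\<close>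

definition quotient_topology :: "'a topology \<Rightarrow> ('a \<Rightarrow> 'b) \<Rightarrow> 'b topology" where
  "quotient_topology X f =
     topology (\<lambda>U. U \<subseteq> f ` topspace X \<and> openin X {x \<in> topspace X. f x \<in> U})"

lemma istopology_quotient:
  "istopology (\<lambda>U. U \<subseteq> f ` topspace X \<and> openin X {x \<in> topspace X. f x \<in> U})"
proof -
  have 1: "{x \<in> topspace X. f x \<in> S \<inter> T} =
      {x \<in> topspace X. f x \<in> S} \<inter> {x \<in> topspace X. f x \<in> T}" for S T
    by auto
  have 2: "{x \<in> topspace X. f x \<in> \<Union> K} = (\<Union>U \<in> K. {x \<in> topspace X. f x \<in> U})" for K
    by auto
  show ?thesis
    unfolding istopology_def 1 2 by blast
qed

lemma openin_quotient_topology: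
  "openin (quotient_topology X f) U \<longleftrightarrow>
     U \<subseteq> f ` topspace X \<and> openin X {x \<in> topspace X. f x \<in> U}"
  unfolding quotient_topology_def topology_inverse'[OF istopology_quotient] ..

lemma topspace_quotient_topology: "topspace (quotient_topology X f) = f ` topspace X"
proof (rule antisym)
  show "topspace (quotient_topology X f) \<subseteq> f ` topspace X"
    by (metis openin_quotient_topology openin_topspace)
  have "{x \<in> topspace X. f x \<in> f ` topspace X} = topspace X"
    by auto
  then have "openin (quotient_topology X f) (f ` topspace X)"
    by (simp add: openin_quotient_topology)
  then show "f ` topspace X \<subseteq> topspace (quotient_topology X f)"
    by (rule openin_subset)
qed

lemma quotient_map_quotient_topology: "quotient_map X (quotient_topology X f) f"
  by (auto simp: quotient_map_def topspace_quotient_topology openin_quotient_topology)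

text \<open>
  Contraction of a set \<open>F\<close> of edges: each class of vertices joined through \<open>F\<close> becomes one vertex,
  labelled by the least element of the class.
\<close>

definition contract_vertex :: "graph \<Rightarrow> nat set \<Rightarrow> nat \<Rightarrow> nat" where
  "contract_vertex G F v =
     (LEAST w. equivclp (\<lambda>a b. \<exists>e \<in> F. tail G e = a \<and> head G e = b) v w)"

definition contract_graph :: "graph \<Rightarrow> nat set \<Rightarrow> graph" where
  "contract_graph G F =
     \<lparr>verts = contract_vertex G F ` verts G, arcs = arcs G - F,
      tail = contract_vertex G F \<circ> tail G, head = contract_vertex G F \<circ> head G\<rparr>"

fun contract_point :: "graph \<Rightarrow> nat set \<Rightarrow> (nat, nat) point \<Rightarrow> (nat, nat) point" where
  "contract_point G F (Vertex v) = Vertex (contract_vertex G F v)"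
| "contract_point G F (Interior e s) =
     (if e \<in> F then Vertex (contract_vertex G F (tail G e)) else Interior e s)"

definition zero_edges :: "graph \<Rightarrow> (nat \<Rightarrow> real) \<Rightarrow> nat set" where
  "zero_edges G l = {e \<in> arcs G. l e = 0}"

definition contract_zero_edges :: "nat \<Rightarrow> marked_graph \<Rightarrow> marked_graph" where
  "contract_zero_edges n = (\<lambda>(G, l, p).
     (contract_graph G (zero_edges G l),
      restrict l (arcs G - zero_edges G l),
      restrict (\<lambda>j. contract_point G (zero_edges G l) (p j)) {1..n}))"

definition length_functions :: "graph \<Rightarrow> (nat \<Rightarrow> real) set" where
  "length_functions G = {l \<in> PiE (arcs G) (\<lambda>_. {0..}). induces_forest G (zero_edges G l)}"

definition chart_space ::
  "nat \<Rightarrow> graph \<Rightarrow> ((nat \<Rightarrow> real) \<times> (nat \<Rightarrow> (nat, nat) point)) topology" where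
  "chart_space n G = prod_topology
     (subtopology (product_topology (\<lambda>_. euclideanreal) (arcs G)) (length_functions G))
     (product_topology (\<lambda>_. realization_topology G) {1..n})"

definition TMb_topology :: "nat \<Rightarrow> nat \<Rightarrow> marked_graph set topology" where
  "TMb_topology g n = quotient_topology
     (sum_topology (chart_space n) (stable_graphs g))
     (\<lambda>x. marked_isometric g n `` {contract_zero_edges n x})"


subsection \<open>The ordered partition of the edges by length, and graphs filtered by forests\<close>

text \<open>Indices start at 1, so \<open>level G l 1 < \<dots> < level G l (num_levels G l)\<close>.\<close>

definition num_levels :: "('v, 'e) pre_digraph \<Rightarrow> ('e \<Rightarrow> real) \<Rightarrow> nat" where
  "num_levels G l = card (l ` arcs G)"

definition level :: "('v, 'e) pre_digraph \<Rightarrow> ('e \<Rightarrow> real) \<Rightarrow> nat \<Rightarrow> real" where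
  "level G l i = sorted_list_of_set (l ` arcs G) ! (i - 1)"

definition block :: "('v, 'e) pre_digraph \<Rightarrow> ('e \<Rightarrow> real) \<Rightarrow> nat \<Rightarrow> 'e set" where
  "block G l i = {e \<in> arcs G. l e = level G l i}"

definition filtered_by_forests :: "('v, 'e) pre_digraph \<Rightarrow> ('e \<Rightarrow> real) \<Rightarrow> bool" where
  "filtered_by_forests G l \<longleftrightarrow> induces_forest G (\<Union>i \<in> {1..num_levels G l - 1}. block G l i)"

definition TMe :: "nat \<Rightarrow> nat \<Rightarrow> marked_graph set set" where
  "TMe g n = {x \<in> TMb g n. \<forall>(G, l, p) \<in> x. filtered_by_forests G l}"


subsection \<open>The deformation\<close>

definition forest_index :: "('v, 'e) pre_digraph \<Rightarrow> ('e \<Rightarrow> real) \<Rightarrow> nat" where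
  "forest_index G l =
     Max {k \<in> {0..num_levels G l}. induces_forest G (\<Union>i \<in> {1..k}. block G l i)}"

definition flow_length :: "('v, 'e) pre_digraph \<Rightarrow> ('e \<Rightarrow> real) \<Rightarrow> real \<Rightarrow> 'e \<Rightarrow> real" where
  "flow_length G l t =
     (let k = forest_index G l; lmax = level G l (num_levels G l) in
      (\<lambda>e \<in> arcs G.
        if e \<in> (\<Union>i \<in> {1..k}. block G l i)
        then l e * (1 + t * (lmax / level G l (Suc k) - 1))
        else l e + t * (lmax - l e)))"

text \<open>
  The marking is unchanged as a map to the topological realization, since \<open>Interior e s\<close> records
  the position relative to the length of \<open>e\<close>. As usual for maps on quotients, the value on a class is
  the union of the classes of the images of its representatives; it is a single class exactly if
  the result does not depend on the representative.
\<close>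

definition Phi :: "nat \<Rightarrow> nat \<Rightarrow> marked_graph set \<Rightarrow> real \<Rightarrow> marked_graph set" where
  "Phi g n x t = (\<Union>(G, l, p) \<in> x. marked_isometric g n `` {(G, flow_length G l t, p)})"

end

theory Submission
  imports Defs
begin

text \<open>
  Let \<open>r\<close> be the least length such that the edges of length at most \<open>r\<close> contain a cycle
  (\<open>cycle_threshold\<close>), which is the level after the forest index, and let \<open>M\<close> be the maximal length.
  Then the deformed length of an edge \<open>e\<close> at time \<open>t\<close> is \<open>(1 - t) * l e + t * (M * min 1 (l e / r))\<close>
  (\<open>flow_length_eq_interpolated_length\<close>): the deformation is the straight line from \<open>l\<close> to the lengths
  that arise by rescaling \<open>r\<close> to \<open>M\<close> and cutting off at \<open>M\<close>. A metric graph is filtered by forests iff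
  \<open>r = M\<close>, in which case the line is constant; and at time 1 the edges shorter than \<open>M\<close> are those that
  were shorter than \<open>r\<close>, which form a forest.
  
  For continuity, \<open>r\<close> is the minimum, over the edge sets \<open>F\<close> that contain a cycle, of the maximal length
  in \<open>F\<close>. So \<open>r\<close> is continuous on each chart. It is positive there, since the edges of length 0 form a
  forest, and the formula defines a continuous deformation of the chart that keeps the edges of length
  0. Contracting a forest of edges of length 0 changes neither \<open>r\<close> nor \<open>M\<close>, because a set of edges that
  contains the forest has a cycle iff its image in the contraction has one
  (\<open>induces_forest_contract_graph\<close>). Hence the deformations of the charts induce \<open>Phi\<close>, and continuity
  descends along the quotient map (\<open>continuous_map_Phi\<close>).
  
  It remains to see that the deformation respects isometries, which are only assumed to preserve
  distances. A stable graph of positive genus is a single loop or has all valencies at least 3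
  (\<open>stable_cases\<close>). A small sphere around a point has as many elements as there are directions at that
  point (\<open>card_sphere\<close>), so an isometry preserves valencies. On a single loop the deformation does
  nothing. Otherwise vertices are mapped to vertices, and edges to edges of the same length by affine
  maps (\<open>maps_edge_exists\<close>); so the isometry is an isomorphism of graphs that preserves lengths, and it
  remains an isometry for the deformed lengths (\<open>isometry_interpolated_length\<close>).
\<close>


section \<open>Cycles and connectivity through a set of edges\<close>

text \<open>
  The relation whose classes become the vertices when \<open>F\<close> is contracted.
\<close>

definition joined :: "('v, 'e) pre_digraph \<Rightarrow> 'e set \<Rightarrow> 'v \<Rightarrow> 'v \<Rightarrow> bool" where
  "joined G F = equivclp (\<lambda>a b. \<exists>e \<in> F. tail G e = a \<and> head G e = b)"

lemma joined_refl [simp]: "joined G F v v"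
  by (simp add: joined_def)

lemma joined_sym: "joined G F u v \<Longrightarrow> joined G F v u"
  unfolding joined_def by (rule equivclp_sym)

lemma joined_trans [trans]: "joined G F u v \<Longrightarrow> joined G F v w \<Longrightarrow> joined G F u w"
  unfolding joined_def by (rule equivclp_trans)

lemma joined_edge: "e \<in> F \<Longrightarrow> joined G F (tail G e) (head G e)"
  unfolding joined_def by (rule r_into_equivclp) blast

lemma joined_induct [consumes 1, case_names refl sym trans edge]:
  assumes "joined G F u v"
    and "\<And>x. R x x" and sym: "\<And>x y. R x y \<Longrightarrow> R y x"
    and trans: "\<And>x y z. R x y \<Longrightarrow> R y z \<Longrightarrow> R x z"
    and edge: "\<And>e. e \<in> F \<Longrightarrow> R (tail G e) (head G e)"
  shows "R u v"
  using assms(1) unfolding joined_def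
proof (induction rule: equivclp_induct)
  case base
  show ?case by fact
next
  case (step y z)
  then have "R y z" using edge sym by blast
  with step.IH show ?case using trans by blast
qed

lemma joined_mono: "joined G F u v \<Longrightarrow> F \<subseteq> F' \<Longrightarrow> joined G F' u v"
  by (induction rule: joined_induct) (auto intro: joined_sym joined_trans joined_edge)

lemma joined_step: "fst s \<in> F \<Longrightarrow> joined G F (step_source G s) (step_target G s)"
  by (simp add: step_source_def step_target_def joined_edge joined_sym)

text \<open>
  The target \<open>v\<close> comes before the source, because it stays fixed while a path is extended at its
  source. Distinct vertices are required at once, so that adding an edge between the ends of a path
  yields a cycle.
\<close>

inductive simple_path ::
  "('v, 'e) pre_digraph \<Rightarrow> 'e set \<Rightarrow> 'v \<Rightarrow> 'v \<Rightarrow> ('e \<times> bool) list \<Rightarrow> bool"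
  for G :: "('v, 'e) pre_digraph" and F :: "'e set" and v :: 'v
where
  simple_path_nil: "simple_path G F v v []"
| simple_path_cons: "\<lbrakk>simple_path G F v (step_target G s) w; fst s \<in> F;
     step_source G s \<noteq> v; step_source G s \<notin> step_source G ` set w\<rbrakk>
    \<Longrightarrow> simple_path G F v (step_source G s) (s # w)"

lemma simple_path_suffix:
  assumes "simple_path G F v u w" and "x = v \<or> x \<in> step_source G ` set w"
  shows "\<exists>w'. simple_path G F v x w'"
  using assms by (induction rule: simple_path.induct) (auto intro: simple_path.intros)

text \<open>
  If the new source is already visited, the part of the path from there on is taken instead.
\<close>

lemma simple_path_extend:
  assumes "simple_path G F v (step_target G s) w" and "fst s \<in> F"
  shows "\<exists>w'. simple_path G F v (step_source G s) w'"
  using assms simple_path_suffix[OF assms(1), of "step_source G s"]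
  by (meson simple_path_cons)

lemma joined_imp_simple_path:
  assumes "joined G F u v"
  shows "\<exists>w. simple_path G F v u w"
  using assms unfolding joined_def
proof (induction rule: converse_equivclp_induct)
  case base
  show ?case by (blast intro: simple_path_nil)
next
  case (step y z)
  then obtain e b where e: "e \<in> F" "step_source G (e, b) = y" "step_target G (e, b) = z"
    unfolding step_source_def step_target_def by (metis fst_conv snd_conv)
  with step.IH show ?case
    using simple_path_extend[where s = "(e, b)" and G = G and F = F] by auto
qed

lemma simple_path_target:
  assumes "simple_path G F v u w" and "s \<in> set w"
  shows "step_target G s = v \<or> step_target G s \<in> step_source G ` set w"
  using assms
proof (induction rule: simple_path.induct)
  case (simple_path_cons s' w)
  from simple_path_cons(1) have "step_target G s' = v \<or> step_target G s' \<in> step_source G ` set w"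
    by (cases rule: simple_path.cases) auto
  with simple_path_cons show ?case by auto
qed simp

lemma simple_path_props:
  assumes "simple_path G F v u w"
  shows "fst ` set w \<subseteq> F" "v \<notin> step_source G ` set w" "distinct (map (step_source G) w)"
    "distinct (map fst w)"
    "u = (if w = [] then v else step_source G (w ! 0))"
    "i < length w \<Longrightarrow>
       step_target G (w ! i) = (if Suc i < length w then step_source G (w ! Suc i) else v)"
proof -
  show "fst ` set w \<subseteq> F" "v \<notin> step_source G ` set w" "distinct (map (step_source G) w)"
    "u = (if w = [] then v else step_source G (w ! 0))"
    using assms by (induction rule: simple_path.induct) auto
  show "distinct (map fst w)"
    using assms
  proof (induction rule: simple_path.induct)
    case (simple_path_cons s w)
    have "fst s \<notin> fst ` set w"
    proof
      assume "fst s \<in> fst ` set w"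
      then obtain s' where s': "s' \<in> set w" "fst s' = fst s" by auto
      then have "step_source G s = step_source G s' \<or> step_source G s = step_target G s'"
        by (auto simp: step_source_def step_target_def)
      then show False
        using simple_path_target[OF simple_path_cons(1) s'(1)] s'(1) simple_path_cons(3,4) by auto
    qed
    with simple_path_cons show ?case by simp
  qed simp
  show "i < length w \<Longrightarrow>
       step_target G (w ! i) = (if Suc i < length w then step_source G (w ! Suc i) else v)"
    using assms
  proof (induction arbitrary: i rule: simple_path.induct)
    case (simple_path_cons s w)
    show ?case
    proof (cases i)
      case 0
      from simple_path_cons(1)
      have "step_target G s = (if w = [] then v else step_source G (w ! 0))"
        by (cases rule: simple_path.cases) auto
      then show ?thesis using 0 by simp
    next
      case (Suc j)
      then show ?thesis using simple_path_cons.IH[of j] simple_path_cons.prems by simp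
    qed
  qed simp
qed

text \<open>
  Going around the cycle the other way joins the ends of each of its edges through the remaining ones.
\<close>

lemma cycle_edge_ends_joined:
  assumes c: "undirected_cycle G c" and s: "s \<in> set c"
  shows "joined G (fst ` set c - {fst s}) (step_target G s) (step_source G s)"
proof -
  let ?n = "length c"
  obtain j where j: "j < ?n" "c ! j = s" using s by (auto simp: in_set_conv_nth)
  have dist: "distinct (map fst c)"
    and next_step: "\<And>i. i < ?n \<Longrightarrow> step_target G (c ! i) = step_source G (c ! (Suc i mod ?n))"
    using c by (auto simp: undirected_cycle_def)
  have n: "?n > 0" using j by linarith
  have "joined G (fst ` set c - {fst s}) (step_target G s) (step_source G (c ! ((j + Suc i) mod ?n)))"
    if "i < ?n" for i
    using that
  proof (induction i)
    case 0
    show ?case using next_step[OF j(1)] j(2) by simp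
  next
    case (Suc i)
    let ?k = "(j + Suc i) mod ?n"
    have k: "?k < ?n" using n by simp
    have "?k \<noteq> j"
    proof
      assume eq: "?k = j"
      show False
      proof (cases "j + Suc i < ?n")
        case True
        then show False using eq by simp
      next
        case False
        then have "?k = (j + Suc i - ?n) mod ?n" by (intro le_mod_geq) simp
        also have "\<dots> = j + Suc i - ?n" using Suc.prems j(1) by (intro mod_less) linarith
        finally show False using eq Suc.prems False by linarith
      qed
    qed
    then have "fst (c ! ?k) \<noteq> fst s"
      using dist j k nth_eq_iff_index_eq[OF dist, of ?k j] by auto
    then have "joined G (fst ` set c - {fst s}) (step_source G (c ! ?k)) (step_target G (c ! ?k))"
      using k by (intro joined_step) auto
    also have "step_target G (c ! ?k) = step_source G (c ! ((j + Suc (Suc i)) mod ?n))"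
      using next_step[OF k] by (simp add: mod_Suc_eq)
    finally show ?case using Suc.IH Suc.prems joined_trans by (metis (no_types) Suc_lessD)
  qed
  from this[of "?n - 1"] show ?thesis using n j by simp
qed

lemma induces_forest_mono: "induces_forest G F \<Longrightarrow> F' \<subseteq> F \<Longrightarrow> induces_forest G F'"
  unfolding induces_forest_def by blast

lemma induces_forest_empty [simp]: "induces_forest G {}"
  by (auto simp: induces_forest_def undirected_cycle_def)

text \<open>
  Unlike a cycle, which is a list, this criterion speaks only of connectivity, so that it can be
  compared on a graph and on its contractions.
\<close>

lemma induces_forest_iff:
  assumes F: "F \<subseteq> arcs G"
  shows "induces_forest G F \<longleftrightarrow> (\<forall>e \<in> F. \<not> joined G (F - {e}) (tail G e) (head G e))"
proof
  assume forest: "induces_forest G F"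
  show "\<forall>e \<in> F. \<not> joined G (F - {e}) (tail G e) (head G e)"
  proof (intro ballI notI)
    fix e assume e: "e \<in> F" and "joined G (F - {e}) (tail G e) (head G e)"
    then obtain w where w: "simple_path G (F - {e}) (tail G e) (head G e) w"
      using joined_imp_simple_path joined_sym by metis
    note wp = simple_path_props[OF w]
    let ?c = "(e, True) # w"
    have "undirected_cycle G ?c"
      unfolding undirected_cycle_def
    proof (intro conjI allI impI)
      show "distinct (map fst ?c)" using wp(1,4) by auto
      show "distinct (map (step_source G) ?c)" using wp(2,3) by (simp add: step_source_def)
      fix i assume i: "i < length ?c"
      show "step_target G (?c ! i) = step_source G (?c ! (Suc i mod length ?c))"
      proof (cases i)
        case 0
        then show ?thesis using wp(5) by (auto simp: step_source_def step_target_def)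
      next
        case (Suc j)
        show ?thesis
        proof (cases "Suc j < length w")
          case True
          then have "Suc i mod length ?c = Suc i" using Suc by (intro mod_less) simp
          then show ?thesis using wp(6)[of j] True Suc by (simp only:) simp
        next
          case False
          then have "Suc i = length ?c" using i Suc by simp
          then have "Suc i mod length ?c = 0" by (simp only: mod_self)
          then show ?thesis using wp(6)[of j] i False Suc by (simp only:) (simp add: step_source_def)
        qed
      qed
    qed (use e F wp(1) in auto)
    moreover have "fst ` set ?c \<subseteq> F" using e wp(1) by auto
    ultimately show False using forest unfolding induces_forest_def by blast
  qed
next
  assume *: "\<forall>e \<in> F. \<not> joined G (F - {e}) (tail G e) (head G e)"
  show "induces_forest G F"
    unfolding induces_forest_def
  proof
    assume "\<exists>c. undirected_cycle G c \<and> fst ` set c \<subseteq> F"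
    then obtain c where c: "undirected_cycle G c" "fst ` set c \<subseteq> F" by blast
    then obtain s where s: "s \<in> set c"
      by (metis undirected_cycle_def list.set_intros(1) neq_Nil_conv)
    have "joined G (F - {fst s}) (step_target G s) (step_source G s)"
      using cycle_edge_ends_joined[OF c(1) s] by (rule joined_mono) (use c in auto)
    then have "joined G (F - {fst s}) (tail G (fst s)) (head G (fst s))"
      by (auto simp: step_source_def step_target_def intro: joined_sym split: if_splits)
    then show False using * c s by auto
  qed
qed


section \<open>Cycles after a contraction\<close>

lemma arcs_contract_graph [simp]: "arcs (contract_graph G Z) = arcs G - Z"
  by (simp add: contract_graph_def)

lemma joined_contract_vertex: "joined G Z v (contract_vertex G Z v)"
  unfolding joined_def contract_vertex_def by (rule LeastI[of _ v]) simp

lemma contract_vertex_eq: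
  assumes "joined G Z u v"
  shows "contract_vertex G Z u = contract_vertex G Z v"
proof -
  have "joined G Z u = joined G Z v"
    using assms by (intro ext) (meson joined_sym joined_trans)
  then show ?thesis unfolding contract_vertex_def joined_def by simp
qed

text \<open>
  Each vertex is joined through \<open>Z\<close> to the vertex it is contracted to, so a path in the contraction
  lifts once the edges of \<open>Z\<close> may be used as well.
\<close>

lemma joined_contract_graph:
  "joined (contract_graph G Z) H (contract_vertex G Z u) (contract_vertex G Z v)
    \<longleftrightarrow> joined G (H \<union> Z) u v"
proof
  have "joined G (H \<union> Z) x y" if "joined (contract_graph G Z) H x y" for x y
    using that
  proof (induction rule: joined_induct)
    case (edge e)
    have cv: "joined G (H \<union> Z) v (contract_vertex G Z v)" for v
      by (rule joined_mono[OF joined_contract_vertex]) simp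
    have "joined G (H \<union> Z) (tail G e) (head G e)"
      using edge by (simp add: joined_edge)
    then show ?case
      using cv[of "tail G e"] cv[of "head G e"]
      by (auto simp: contract_graph_def intro: joined_sym joined_trans)
  qed (auto intro: joined_sym joined_trans)
  moreover have "joined G (H \<union> Z) v (contract_vertex G Z v)" for v
    by (rule joined_mono[OF joined_contract_vertex]) simp
  ultimately show "joined G (H \<union> Z) u v"
    if "joined (contract_graph G Z) H (contract_vertex G Z u) (contract_vertex G Z v)"
    using that by (meson joined_sym joined_trans)
next
  assume "joined G (H \<union> Z) u v"
  then show "joined (contract_graph G Z) H (contract_vertex G Z u) (contract_vertex G Z v)"
  proof (induction rule: joined_induct)
    case (edge e)
    show ?case
    proof (cases "e \<in> Z")
      case True
      then show ?thesis using contract_vertex_eq[OF joined_edge[OF True]] by simp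
    next
      case False
      with edge have "e \<in> H" by blast
      from joined_edge[OF this, of "contract_graph G Z"] show ?thesis
        by (simp add: contract_graph_def)
    qed
  qed (auto intro: joined_sym joined_trans)
qed

text \<open>
  A cycle in \<open>F\<close> contains an edge outside the forest \<open>Z\<close>, and the ends of this edge remain
  joined through the other edges after contracting \<open>Z\<close>.
\<close>

lemma induces_forest_contract_graph:
  assumes "Z \<subseteq> F" "F \<subseteq> arcs G" and Z: "induces_forest G Z"
  shows "induces_forest (contract_graph G Z) (F - Z) \<longleftrightarrow> induces_forest G F"
proof -
  have iff: "joined (contract_graph G Z) (F - Z - {e}) (tail (contract_graph G Z) e)
      (head (contract_graph G Z) e) \<longleftrightarrow> joined G (F - {e}) (tail G e) (head G e)"
    if "e \<in> F - Z" for e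
  proof -
    have "(F - Z - {e}) \<union> Z = F - {e}" using that assms(1) by auto
    then show ?thesis
      using joined_contract_graph[of G Z "F - Z - {e}" "tail G e" "head G e"]
      by (simp add: contract_graph_def)
  qed
  show ?thesis
  proof
    assume "induces_forest G F"
    then show "induces_forest (contract_graph G Z) (F - Z)"
      using assms iff by (subst induces_forest_iff) (auto simp: induces_forest_iff)
  next
    assume *: "induces_forest (contract_graph G Z) (F - Z)"
    show "induces_forest G F"
      unfolding induces_forest_def
    proof
      assume "\<exists>c. undirected_cycle G c \<and> fst ` set c \<subseteq> F"
      then obtain c where c: "undirected_cycle G c" "fst ` set c \<subseteq> F" by blast
      with Z obtain s where s: "s \<in> set c" "fst s \<notin> Z"
        unfolding induces_forest_def by blast
      have "joined G (F - {fst s}) (step_target G s) (step_source G s)"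
        using cycle_edge_ends_joined[OF c(1) s(1)] by (rule joined_mono) (use c in auto)
      then have "joined G (F - {fst s}) (tail G (fst s)) (head G (fst s))"
        by (auto simp: step_source_def step_target_def intro: joined_sym split: if_splits)
      moreover have "fst s \<in> F - Z" using s c by auto
      moreover have "F - Z \<subseteq> arcs (contract_graph G Z)" using assms by auto
      ultimately show False using * iff induces_forest_iff by blast
    qed
  qed
qed


section \<open>The deformation in closed form\<close>

text \<open>
  The least length \<open>r\<close> for which the edges of length at most \<open>r\<close> contain a cycle. Written as a minimum
  of maxima over the edge sets that contain a cycle, it is visibly continuous in \<open>l\<close>.
\<close>

definition cycle_threshold :: "('v, 'e) pre_digraph \<Rightarrow> ('e \<Rightarrow> real) \<Rightarrow> real" where
  "cycle_threshold G l = Min ((\<lambda>F. Max (l ` F)) ` {F. F \<subseteq> arcs G \<and> \<not> induces_forest G F})"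

lemma cycle_threshold_props:
  assumes fin: "finite (arcs G)" and cyc: "\<not> induces_forest G (arcs G)"
  shows "\<not> induces_forest G {e \<in> arcs G. l e \<le> cycle_threshold G l}"
    and "induces_forest G {e \<in> arcs G. l e < cycle_threshold G l}"
    and "cycle_threshold G l \<in> l ` arcs G"
proof -
  let ?S = "{F. F \<subseteq> arcs G \<and> \<not> induces_forest G F}"
  have S: "finite ?S" "?S \<noteq> {}" using fin cyc by auto
  have nonempty: "F \<noteq> {}" if "F \<in> ?S" for F
  proof
    assume "F = {}"
    with that show False by simp
  qed
  have fin': "finite F" if "F \<in> ?S" for F using that fin by (auto intro: finite_subset)
  have "cycle_threshold G l \<in> (\<lambda>F. Max (l ` F)) ` ?S"
    unfolding cycle_threshold_def using S by (intro Min_in) auto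
  then obtain F where F: "F \<in> ?S" "cycle_threshold G l = Max (l ` F)" by blast
  have "F \<subseteq> {e \<in> arcs G. l e \<le> cycle_threshold G l}"
    using F fin'[OF F(1)] by auto
  then show "\<not> induces_forest G {e \<in> arcs G. l e \<le> cycle_threshold G l}"
    using F(1) induces_forest_mono by blast
  have "Max (l ` F) \<in> l ` F" using fin'[OF F(1)] nonempty[OF F(1)] by (intro Max_in) auto
  then show "cycle_threshold G l \<in> l ` arcs G" using F by auto
  show "induces_forest G {e \<in> arcs G. l e < cycle_threshold G l}" (is "induces_forest G ?F")
  proof (rule ccontr)
    assume "\<not> induces_forest G ?F"
    then have F': "?F \<in> ?S" by auto
    then have "cycle_threshold G l \<le> Max (l ` ?F)"
      unfolding cycle_threshold_def using S by (intro Min_le) auto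
    moreover have "Max (l ` ?F) < cycle_threshold G l"
      using fin'[OF F'] nonempty[OF F'] by (subst Max_less_iff) auto
    ultimately show False by simp
  qed
qed

text \<open>
  The threshold is thus determined by the sublevel sets of the length function, which makes it easy
  to compare on different graphs.
\<close>

lemma cycle_threshold_unique:
  assumes fin: "finite (arcs G)"
    and cyc: "\<not> induces_forest G {e \<in> arcs G. l e \<le> r}"
    and forest: "induces_forest G {e \<in> arcs G. l e < r}"
  shows "cycle_threshold G l = r"
proof -
  have "\<not> induces_forest G (arcs G)"
    using cyc induces_forest_mono[of G "arcs G"] by (metis (no_types, lifting) mem_Collect_eq subsetI)
  note props = cycle_threshold_props[OF fin this, of l]
  have "\<not> cycle_threshold G l < r"
  proof
    assume "cycle_threshold G l < r"
    then have "{e \<in> arcs G. l e \<le> cycle_threshold G l} \<subseteq> {e \<in> arcs G. l e < r}" by auto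
    then show False using props(1) forest induces_forest_mono by blast
  qed
  moreover have "\<not> r < cycle_threshold G l"
  proof
    assume "r < cycle_threshold G l"
    then have "{e \<in> arcs G. l e \<le> r} \<subseteq> {e \<in> arcs G. l e < cycle_threshold G l}" by auto
    then show False using props(2) cyc induces_forest_mono by blast
  qed
  ultimately show ?thesis by simp
qed

lemma cycle_threshold_pos:
  assumes "finite (arcs G)" "\<not> induces_forest G (arcs G)" "\<And>e. e \<in> arcs G \<Longrightarrow> 0 < l e"
  shows "0 < cycle_threshold G l"
  using cycle_threshold_props(3)[OF assms(1,2), of l] assms(3) by auto

lemma level_less:
  assumes "finite (arcs G)" "1 \<le> i" "i < j" "j \<le> num_levels G l"
  shows "level G l i < level G l j"
  using assms sorted_wrt_nth_less[OF strict_sorted_list_of_set, of "i - 1" "j - 1" "l ` arcs G"]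
  by (simp add: level_def num_levels_def)

lemma level_image:
  assumes "finite (arcs G)"
  shows "level G l ` {1..num_levels G l} = l ` arcs G"
proof -
  let ?xs = "sorted_list_of_set (l ` arcs G)"
  have "{1..num_levels G l} = Suc ` {..<num_levels G l}"
    by (simp add: lessThan_atLeast0 image_Suc_atLeastLessThan atLeastLessThanSuc_atLeastAtMost)
  then have "level G l ` {1..num_levels G l} = (\<lambda>i. ?xs ! i) ` {..<length ?xs}"
    by (simp add: level_def image_image num_levels_def)
  also have "\<dots> = set ?xs" by (auto simp: set_conv_nth)
  finally show ?thesis using assms by simp
qed

lemma blocks_below:
  assumes fin: "finite (arcs G)" and k: "k < num_levels G l"
  shows "(\<Union>i \<in> {1..k}. block G l i) = {e \<in> arcs G. l e < level G l (Suc k)}"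
proof -
  have "(\<exists>i \<in> {1..k}. l e = level G l i) \<longleftrightarrow> l e < level G l (Suc k)" if e: "e \<in> arcs G" for e
  proof
    assume "\<exists>i \<in> {1..k}. l e = level G l i"
    then show "l e < level G l (Suc k)" using level_less[OF fin] k by auto
  next
    assume *: "l e < level G l (Suc k)"
    from e have "l e \<in> level G l ` {1..num_levels G l}" using level_image[OF fin, of l] by blast
    then obtain i where i: "i \<in> {1..num_levels G l}" "l e = level G l i" by auto
    have "i \<le> k"
    proof (rule ccontr)
      assume "\<not> i \<le> k"
      then have "level G l (Suc k) \<le> level G l i"
        using level_less[OF fin, of "Suc k" i l] i by (cases "i = Suc k") auto
      with * i show False by simp
    qed
    with i show "\<exists>i \<in> {1..k}. l e = level G l i" by auto
  qed
  then show ?thesis by (auto simp: block_def)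
qed

lemma blocks_upto:
  assumes "finite (arcs G)" "Suc k \<le> num_levels G l"
  shows "(\<Union>i \<in> {1..Suc k}. block G l i) = {e \<in> arcs G. l e \<le> level G l (Suc k)}"
proof -
  have "(\<Union>i \<in> {1..Suc k}. block G l i) = (\<Union>i \<in> {1..k}. block G l i) \<union> block G l (Suc k)"
    by (simp add: atLeastAtMostSuc_conv Un_commute)
  also have "\<dots> = {e \<in> arcs G. l e \<le> level G l (Suc k)}"
    using assms by (subst blocks_below) (auto simp: block_def)
  finally show ?thesis .
qed

lemma level_num_levels:
  assumes "finite (arcs G)" "arcs G \<noteq> {}"
  shows "num_levels G l \<ge> 1" "level G l (num_levels G l) = Max (l ` arcs G)"
proof -
  show m: "num_levels G l \<ge> 1"
    using assms by (simp add: num_levels_def Suc_le_eq card_gt_0_iff)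
  have "level G l i \<le> level G l (num_levels G l)" if "i \<in> {1..num_levels G l}" for i
    using level_less[OF assms(1), of i "num_levels G l" l] that by (cases "i = num_levels G l") auto
  then have "Max (level G l ` {1..num_levels G l}) = level G l (num_levels G l)"
    using m by (intro Max_eqI) auto
  then show "level G l (num_levels G l) = Max (l ` arcs G)"
    using level_image[OF assms(1), of l] by simp
qed

text \<open>
  By maximality of the index, its successor is the first level at which a cycle appears.
\<close>

lemma level_forest_index:
  assumes fin: "finite (arcs G)" and cyc: "\<not> induces_forest G (arcs G)"
  shows "forest_index G l < num_levels G l"
    and "level G l (Suc (forest_index G l)) = cycle_threshold G l"
proof -
  let ?k = "forest_index G l" and ?m = "num_levels G l"
  let ?K = "{k \<in> {0..?m}. induces_forest G (\<Union>i \<in> {1..k}. block G l i)}"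
  have "0 \<in> ?K" by simp
  then have "?K \<noteq> {}" by blast
  then have k: "?k \<in> ?K" unfolding forest_index_def by (intro Max_in) auto
  have "arcs G \<noteq> {}" using cyc by auto
  then have "?m \<ge> 1" and M: "level G l ?m = Max (l ` arcs G)" by (rule level_num_levels[OF fin])+
  then have "(\<Union>i \<in> {1..?m}. block G l i) = {e \<in> arcs G. l e \<le> Max (l ` arcs G)}"
    using blocks_upto[OF fin, of "?m - 1" l] by simp
  also have "\<dots> = arcs G" using fin by auto
  finally have "?k \<noteq> ?m" using k cyc by auto
  with k show less: "?k < ?m" by simp
  have "Suc ?k \<notin> ?K"
    using Max_ge[of ?K "Suc ?k"] unfolding forest_index_def[symmetric] by auto
  then have "\<not> induces_forest G {e \<in> arcs G. l e \<le> level G l (Suc ?k)}"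
    using less blocks_upto[OF fin, of ?k l] by auto
  moreover have "induces_forest G {e \<in> arcs G. l e < level G l (Suc ?k)}"
    using k blocks_below[OF fin less] by auto
  ultimately show "level G l (Suc ?k) = cycle_threshold G l"
    by (rule cycle_threshold_unique[OF fin, symmetric])
qed

text \<open>
  At time 1 the lengths are rescaled so that the threshold becomes the maximal length, and cut off
  there; in between the lengths are interpolated linearly. Since no case distinction on the edges
  is left, the formula is continuous also where the ordered partition changes.
\<close>

definition interpolated_length ::
  "('v, 'e) pre_digraph \<Rightarrow> ('e \<Rightarrow> real) \<Rightarrow> real \<Rightarrow> 'e \<Rightarrow> real" where
  "interpolated_length G l t = (\<lambda>e \<in> arcs G.
     (1 - t) * l e + t * (Max (l ` arcs G) * min 1 (l e / cycle_threshold G l)))"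

text \<open>
  The blocks up to the forest index consist of the edges below the threshold, where the minimum is
  \<open>l e / cycle_threshold G l\<close>; on all other edges it is 1.
\<close>

lemma flow_length_eq_interpolated_length:
  assumes fin: "finite (arcs G)" and cyc: "\<not> induces_forest G (arcs G)"
    and pos: "\<And>e. e \<in> arcs G \<Longrightarrow> 0 < l e"
  shows "flow_length G l t = interpolated_length G l t"
proof
  fix e
  let ?M = "Max (l ` arcs G)" and ?r = "cycle_threshold G l"
  have r: "?r > 0" by (rule cycle_threshold_pos[OF assms])
  have M: "level G l (num_levels G l) = ?M"
    using level_num_levels[OF fin] cyc by (metis induces_forest_empty)
  have "(\<Union>i \<in> {1..forest_index G l}. block G l i) = {e \<in> arcs G. l e < ?r}"
    using blocks_below[OF fin level_forest_index(1)[OF fin cyc]] level_forest_index(2)[OF fin cyc]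
    by simp
  then have "flow_length G l t = (\<lambda>e \<in> arcs G. if l e < ?r
      then l e * (1 + t * (?M / ?r - 1)) else l e + t * (?M - l e))"
    unfolding flow_length_def Let_def M level_forest_index(2)[OF fin cyc]
    by (auto simp: restrict_def)
  then show "flow_length G l t e = interpolated_length G l t e"
    using r by (auto simp: interpolated_length_def min_def field_simps)
qed

text \<open>
  The edges of all blocks but the last are those shorter than the maximal length; they form a forest
  iff no cycle appears below that length.
\<close>

lemma filtered_by_forests_iff:
  assumes fin: "finite (arcs G)" and cyc: "\<not> induces_forest G (arcs G)"
  shows "filtered_by_forests G l \<longleftrightarrow> cycle_threshold G l = Max (l ` arcs G)"
proof -
  let ?M = "Max (l ` arcs G)"
  have "arcs G \<noteq> {}" using cyc by auto
  from level_num_levels[OF fin this, of l]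
  have "filtered_by_forests G l \<longleftrightarrow> induces_forest G {e \<in> arcs G. l e < ?M}"
    unfolding filtered_by_forests_def
    using blocks_below[OF fin, of "num_levels G l - 1" l] by (cases "num_levels G l") (auto simp: Suc_le_eq)
  moreover have "{e \<in> arcs G. l e \<le> ?M} = arcs G" using fin by auto
  ultimately show ?thesis
    using cycle_threshold_unique[OF fin, of l ?M] cycle_threshold_props(2)[OF fin cyc, of l] cyc
    by auto
qed

lemma interpolated_length_0: "l \<in> extensional (arcs G) \<Longrightarrow> interpolated_length G l 0 = l"
  by (auto simp: interpolated_length_def extensional_def)

text \<open>
  On a graph filtered by forests the threshold is the maximal length, so there is nothing to
  interpolate.
\<close>

lemma interpolated_length_filtered:
  assumes fin: "finite (arcs G)" and cyc: "\<not> induces_forest G (arcs G)"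
    and pos: "\<And>e. e \<in> arcs G \<Longrightarrow> 0 < l e" and ext: "l \<in> extensional (arcs G)"
    and "filtered_by_forests G l"
  shows "interpolated_length G l t = l"
proof
  fix e
  let ?M = "Max (l ` arcs G)"
  have thr: "cycle_threshold G l = ?M" using filtered_by_forests_iff[OF fin cyc] assms by blast
  have "?M > 0" using cycle_threshold_pos[of G l] fin cyc pos thr by simp
  moreover have "l e \<le> ?M" if "e \<in> arcs G"
    using that fin by simp
  ultimately have "?M * min 1 (l e / ?M) = l e" if "e \<in> arcs G"
    using that by (fastforce simp: min_def)
  then show "interpolated_length G l t e = l e"
    using ext by (auto simp: interpolated_length_def thr extensional_def algebra_simps)
qed

text \<open>
  The lengths at time 1 are strictly increasing in \<open>l e\<close> below the threshold and maximal from the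
  threshold on. So the edges that are not longest are those below the threshold, a forest.
\<close>

lemma filtered_interpolated_length_1:
  assumes fin: "finite (arcs G)" and cyc: "\<not> induces_forest G (arcs G)"
    and pos: "\<And>e. e \<in> arcs G \<Longrightarrow> 0 < l e"
  shows "filtered_by_forests G (interpolated_length G l 1)"
proof -
  let ?M = "Max (l ` arcs G)" and ?r = "cycle_threshold G l" and ?l = "interpolated_length G l 1"
  have r: "?r > 0" by (rule cycle_threshold_pos[OF assms])
  have "?r \<in> l ` arcs G" by (rule cycle_threshold_props(3)[OF fin cyc])
  then obtain e where e: "e \<in> arcs G" "l e = ?r" by auto
  have "?r \<le> ?M" using fin \<open>?r \<in> l ` arcs G\<close> by (intro Max_ge) auto
  with r have M: "?M > 0" by linarith
  have l: "?l e = ?M * min 1 (l e / ?r)" if "e \<in> arcs G" for e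
    using that by (simp add: interpolated_length_def)
  have le: "?l e \<le> ?M" if "e \<in> arcs G" for e
    using l[OF that] M by (simp add: mult_left_le)
  have "?l e = ?M" using l[OF e(1)] e r by simp
  then have max: "Max (?l ` arcs G) = ?M"
    using le fin e by (intro Max_eqI) (auto intro: rev_image_eqI)
  have "{e \<in> arcs G. ?l e \<le> ?M} = arcs G" using le by auto
  moreover have "{e \<in> arcs G. ?l e < ?M} = {e \<in> arcs G. l e < ?r}"
    using l M r by (auto simp: mult_less_cancel_left2 pos_divide_less_eq min_less_iff_disj)
  ultimately have "cycle_threshold G ?l = ?M"
    using cyc cycle_threshold_props(2)[OF fin cyc, of l] by (intro cycle_threshold_unique[OF fin]) auto
  then show ?thesis using max filtered_by_forests_iff[OF fin cyc] by simp
qed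


section \<open>Connected and stable graphs\<close>

lemma connected_imp_joined:
  assumes "Digraph_Component.connected G" "u \<in> verts G" "v \<in> verts G"
  shows "joined G (arcs G) u v"
proof -
  have "u \<rightarrow>\<^sup>*\<^bsub>with_proj (mk_symmetric G)\<^esub> v"
    using assms by (auto simp: Digraph_Component.connected_def strongly_connected_def mk_symmetric_def)
  then have "(u, v) \<in> (arcs_ends (with_proj (mk_symmetric G)))\<^sup>*"
    unfolding reachable_def by (rule rtrancl_on_rtranclI)
  then show ?thesis
  proof (induction rule: rtrancl_induct)
    case (step y z)
    then have "\<exists>e \<in> arcs G. (y, z) = (tail G e, head G e) \<or> (y, z) = (head G e, tail G e)"
      by (auto simp: mk_symmetric_def arcs_ends_def arc_to_ends_def)
    then have "joined G (arcs G) y z" using joined_edge joined_sym by fastforce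
    with step.IH show ?case using joined_trans by metis
  qed simp
qed

text \<open>
  A graph without bridges remains connected when an edge is deleted.
\<close>

lemma joined_without_edge:
  assumes "stable G" "e \<in> arcs G" "u \<in> verts G" "v \<in> verts G"
  shows "joined G (arcs G - {e}) u v"
proof -
  have "Digraph_Component.connected (pre_digraph.del_arc G e)"
    using assms by (auto simp: stable_def bridge_def)
  from connected_imp_joined[OF this, of u v] show ?thesis
    using assms by (simp add: joined_def pre_digraph.del_arc_def)
qed

lemma stable_not_forest:
  assumes "stable G" "arcs G \<noteq> {}"
  shows "\<not> induces_forest G (arcs G)"
proof -
  from assms obtain e where e: "e \<in> arcs G" by blast
  interpret fin_digraph G using assms by (simp add: stable_def)
  have "joined G (arcs G - {e}) (tail G e) (head G e)"
    using joined_without_edge[OF assms(1) e] e by simp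
  with e show ?thesis by (auto simp: induces_forest_iff)
qed

lemma genus_pos_arcs_nonempty:
  assumes "stable G" "genus G \<ge> 1"
  shows "arcs G \<noteq> {}"
proof
  assume "arcs G = {}"
  moreover have "card (verts G) > 0"
    using assms by (auto simp: stable_def Digraph_Component.connected_def strongly_connected_def
        mk_symmetric_def card_gt_0_iff fin_digraph.finite_verts)
  ultimately show False using assms by (simp add: genus_def)
qed

definition half_edges :: "('v, 'e) pre_digraph \<Rightarrow> 'v \<Rightarrow> ('e \<times> bool) set" where
  "half_edges G v = {s. fst s \<in> arcs G \<and> step_source G s = v}"

lemma finite_half_edges: "finite (arcs G) \<Longrightarrow> finite (half_edges G v)"
  by (rule finite_subset[of _ "arcs G \<times> UNIV"]) (auto simp: half_edges_def)

lemma card_half_edges: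
  assumes "finite (arcs G)"
  shows "card (half_edges G v) = valency G v"
proof -
  have "half_edges G v = in_arcs G v \<times> {False} \<union> out_arcs G v \<times> {True}"
    by (auto simp: half_edges_def step_source_def in_arcs_def out_arcs_def split: if_splits)
  moreover have "finite (in_arcs G v)" "finite (out_arcs G v)"
    using assms by (simp_all add: in_arcs_def out_arcs_def)
  ultimately show ?thesis
    by (simp add: card_Un_disjoint valency_def in_degree_def out_degree_def disjoint_iff)
qed

text \<open>
  The property of being equal to \<open>v\<close> changes from \<open>v\<close> to \<open>w\<close>, hence along some edge.
\<close>

lemma joined_imp_crossing_edge:
  assumes "joined G F v w" "v \<noteq> w"
  shows "\<exists>s. fst s \<in> F \<and> step_source G s = v \<and> step_target G s \<noteq> v"
proof (rule ccontr)
  assume none: "\<not> ?thesis"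
  have "x = v \<longleftrightarrow> y = v" if "joined G F x y" for x y
    using that
  proof (induction rule: joined_induct)
    case (edge e)
    then show ?case
      using none[unfolded not_ex, THEN spec, of "(e, True)"] none[unfolded not_ex, THEN spec, of "(e, False)"]
      by (auto simp: step_source_def step_target_def)
  qed auto
  with assms show False by metis
qed

text \<open>
  A vertex of valency at most 2 in a larger graph meets two edges leaving it, since there are no
  bridges; then it has valency 2 and must carry a loop, which raises the valency to 4.
\<close>

lemma stable_cases:
  assumes st: "stable G" and genus: "genus G \<ge> 1"
  obtains (loop) e where "arcs G = {e}"
  | (branching) "\<forall>v \<in> verts G. valency G v \<ge> 3"
proof -
  interpret fin_digraph G using st by (simp add: stable_def)
  note fin = finite_arcs
  have "\<exists>e. arcs G = {e}" if v: "v \<in> verts G" and val: "\<not> valency G v \<ge> 3" for v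
  proof (cases "verts G = {v}")
    case True
    have ends: "tail G e = v" "head G e = v" if "e \<in> arcs G" for e
      using tail_in_verts[OF that] head_in_verts[OF that] True by simp_all
    have "half_edges G v = arcs G \<times> UNIV"
    proof (rule set_eqI)
      fix s
      show "s \<in> half_edges G v \<longleftrightarrow> s \<in> arcs G \<times> UNIV"
        using ends[of "fst s"] by (cases s) (auto simp: half_edges_def step_source_def)
    qed
    then have "2 * card (arcs G) \<le> 2"
      using card_half_edges[OF fin, of v] val by (simp add: card_cartesian_product)
    moreover have "card (arcs G) \<ge> 1" using genus True by (simp add: genus_def)
    ultimately have "card (arcs G) = 1" by simp
    then show ?thesis by (simp add: card_1_singleton_iff)
  next
    case False
    with v obtain w where w: "w \<in> verts G" "w \<noteq> v" by blast
    have "joined G (arcs G) v w"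
      using st v w by (intro connected_imp_joined) (auto simp: stable_def)
    then obtain s where s: "fst s \<in> arcs G" "step_source G s = v" "step_target G s \<noteq> v"
      using joined_imp_crossing_edge w by metis
    have "joined G (arcs G - {fst s}) v w"
      using joined_without_edge st s v w by metis
    then obtain s' where s': "fst s' \<in> arcs G - {fst s}" "step_source G s' = v" "step_target G s' \<noteq> v"
      using joined_imp_crossing_edge w by metis
    have "{s, s'} \<subseteq> half_edges G v" using s s' by (simp add: half_edges_def)
    then have "card {s, s'} \<le> valency G v"
      using card_mono[OF finite_half_edges[OF fin]] card_half_edges[OF fin] by metis
    moreover have "s \<noteq> s'" using s'(1) by auto
    ultimately have "valency G v = 2" using val by simp
    then obtain e where e: "e \<in> arcs G" "tail G e = v" "head G e = v"
      using st v by (auto simp: stable_def)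
    have "fst s \<noteq> e" "fst s' \<noteq> e"
      using s s' e by (auto simp: step_target_def split: if_splits)
    then have "s \<noteq> (e, b)" "s' \<noteq> (e, b)" for b by auto
    then have "card {s, s', (e, True), (e, False)} = 4" using \<open>s \<noteq> s'\<close> by simp
    moreover have "{s, s', (e, True), (e, False)} \<subseteq> half_edges G v"
      using s s' e by (simp add: half_edges_def step_source_def)
    ultimately have "4 \<le> valency G v"
      using card_mono[OF finite_half_edges[OF fin]] card_half_edges[OF fin] by metis
    with val show ?thesis by simp
  qed
  then show thesis using loop branching by blast
qed


section \<open>The metric near a point\<close>

lemma interior_in_realization [simp]:
  "Interior e s \<in> realization G \<longleftrightarrow> e \<in> arcs G \<and> 0 < s \<and> s < 1"
  by (auto simp: realization_def)

lemma vertex_in_realization [simp]: "Vertex v \<in> realization G \<longleftrightarrow> v \<in> verts G"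
  by (auto simp: realization_def)

lemma edge_point_interior: "0 < s \<Longrightarrow> s < 1 \<Longrightarrow> edge_point G e s = Interior e s"
  by (simp add: edge_point_def)

lemma edge_point_0 [simp]: "edge_point G e 0 = Vertex (tail G e)"
  and edge_point_1 [simp]: "edge_point G e 1 = Vertex (head G e)"
  by (simp_all add: edge_point_def)

text \<open>
  Closed form for the distance from \<open>x\<close> cut off at a radius \<open>\<rho>\<close> so small that the ball around \<open>x\<close>
  is a star.
\<close>

fun local_dist :: "('v, 'e) pre_digraph \<Rightarrow> ('e \<Rightarrow> real) \<Rightarrow> real \<Rightarrow>
    ('v, 'e) point \<Rightarrow> ('v, 'e) point \<Rightarrow> real" where
  "local_dist G l \<rho> (Vertex v) (Vertex w) = (if v = w then 0 else \<rho>)"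
| "local_dist G l \<rho> (Vertex v) (Interior e s) = min \<rho> (min
     (if tail G e = v then l e * s else \<rho>) (if head G e = v then l e * (1 - s) else \<rho>))"
| "local_dist G l \<rho> (Interior e s) (Vertex v) = \<rho>"
| "local_dist G l \<rho> (Interior e s) (Interior e' s') = (if e = e' then min \<rho> (l e * \<bar>s - s'\<bar>) else \<rho>)"

fun star_radius :: "('v, 'e) pre_digraph \<Rightarrow> ('e \<Rightarrow> real) \<Rightarrow> real \<Rightarrow> ('v, 'e) point \<Rightarrow> bool" where
  "star_radius G l \<rho> (Vertex v) \<longleftrightarrow> 0 < \<rho> \<and> (\<forall>e \<in> arcs G. \<rho> \<le> l e)"
| "star_radius G l \<rho> (Interior e s) \<longleftrightarrow> 0 < \<rho> \<and> \<rho> \<le> l e * s \<and> \<rho> \<le> l e * (1 - s)"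

lemma star_radius_pos: "star_radius G l \<rho> x \<Longrightarrow> 0 < \<rho>"
  by (cases x) auto

text \<open>The number of directions in which one can leave a point.\<close>

fun point_valency :: "('v, 'e) pre_digraph \<Rightarrow> ('v, 'e) point \<Rightarrow> nat" where
  "point_valency G (Vertex v) = valency G v"
| "point_valency G (Interior e s) = 2"

locale metric_graph =
  fixes G :: "('v, 'e) pre_digraph" and l :: "'e \<Rightarrow> real"
  assumes fin_digraph: "fin_digraph G"
    and joined_verts: "\<lbrakk>u \<in> verts G; v \<in> verts G\<rbrakk> \<Longrightarrow> joined G (arcs G) u v"
    and pos: "e \<in> arcs G \<Longrightarrow> 0 < l e"
begin

sublocale fin_digraph G by (rule fin_digraph)

lemma edge_point_in: "e \<in> arcs G \<Longrightarrow> 0 \<le> s \<Longrightarrow> s \<le> 1 \<Longrightarrow> edge_point G e s \<in> realization G"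
  by (rule edge_point_in_realization) (auto intro: wf_digraph_axioms)

lemma route_nonneg: "route G l x y r \<Longrightarrow> 0 \<le> r"
  by (induction rule: route.induct) (auto simp: less_imp_le pos)

lemma route_trans: "route G l x y r \<Longrightarrow> route G l y z r' \<Longrightarrow> route G l x z (r + r')"
  by (induction rule: route.induct) (auto simp: add.assoc intro: route_move)

lemma route_edge:
  assumes "e \<in> arcs G" "s \<in> {0..1}" "s' \<in> {0..1}"
  shows "route G l (edge_point G e s) (edge_point G e s') (l e * \<bar>s - s'\<bar>)"
  using route_move[OF assms route_stay] edge_point_in assms by fastforce

lemma route_verts:
  assumes "joined G (arcs G) u v" "u \<in> verts G"
  shows "\<exists>r. route G l (Vertex u) (Vertex v) r"
  using assms(1) unfolding joined_def
proof (induction rule: equivclp_induct)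
  case base
  show ?case using assms(2) by (intro exI[of _ 0] route_stay) simp
next
  case (step y z)
  then obtain e where "e \<in> arcs G" "tail G e = y \<and> head G e = z \<or> tail G e = z \<and> head G e = y"
    by blast
  then have "\<exists>r. route G l (Vertex y) (Vertex z) r"
    using route_edge[of e 0 1] route_edge[of e 1 0] by auto
  with step.IH show ?case using route_trans by blast
qed

lemma route_to_vertex:
  assumes "x \<in> realization G"
  shows "\<exists>v \<in> verts G. (\<exists>r. route G l x (Vertex v) r) \<and> (\<exists>r. route G l (Vertex v) x r)"
proof (cases x)
  case (Vertex v)
  then show ?thesis using assms route_stay[OF assms] by auto
next
  case (Interior e s)
  then have "e \<in> arcs G" "0 < s" "s < 1" using assms by auto
  then show ?thesis
    using Interior route_edge[of e s 0] route_edge[of e 0 s]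
    by (intro bexI[of _ "tail G e"]) (auto simp: edge_point_interior)
qed

lemma route_exists:
  assumes "x \<in> realization G" "y \<in> realization G"
  shows "\<exists>r. route G l x y r"
  using route_to_vertex[OF assms(1)] route_to_vertex[OF assms(2)] joined_verts route_verts route_trans
  by meson

lemma dist_le: "route G l x y r \<Longrightarrow> realization_dist G l x y \<le> r"
  unfolding realization_dist_def
  by (rule cInf_lower) (auto intro: bdd_belowI[of _ 0] route_nonneg)

text \<open>
  Lower bounds for the distance come from potentials: a function that is 1-Lipschitz along each
  edge is 1-Lipschitz along each route.
\<close>

lemma dist_ge_potential:
  assumes lip: "\<And>e s s'. \<lbrakk>e \<in> arcs G; s \<in> {0..1}; s' \<in> {0..1}\<rbrakk>
      \<Longrightarrow> \<bar>h (edge_point G e s) - h (edge_point G e s')\<bar> \<le> l e * \<bar>s - s'\<bar>"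
    and xy: "x \<in> realization G" "y \<in> realization G"
  shows "\<bar>h x - h y\<bar> \<le> realization_dist G l x y"
proof -
  have "\<bar>h x - h y\<bar> \<le> r" if "route G l x y r" for r
    using that
  proof (induction rule: route.induct)
    case (route_move e s s' y r)
    then show ?case using lip[of e s s'] by linarith
  qed simp
  then show ?thesis
    unfolding realization_dist_def using route_exists[OF xy] by (intro cInf_greatest) auto
qed

lemma local_dist_edge_point:
  assumes "star_radius G l \<rho> x" "e \<in> arcs G" "0 \<le> s" "s \<le> 1"
  shows "local_dist G l \<rho> x (edge_point G e s) = (case x of
      Vertex v \<Rightarrow> min \<rho> (min
        (if tail G e = v then l e * s else \<rho>) (if head G e = v then l e * (1 - s) else \<rho>))
    | Interior e' s' \<Rightarrow> if e' = e then min \<rho> (l e * \<bar>s' - s\<bar>) else \<rho>)"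
proof (cases x)
  case (Vertex v)
  then show ?thesis
    using assms pos[OF assms(2)] by (auto simp: edge_point_def min_def)
next
  case (Interior e' s')
  show ?thesis
  proof (cases "e' = e")
    case True
    then have "0 < l e * s'" "0 < l e * (1 - s')" using assms(1) Interior by auto
    then have "0 < s'" "s' < 1" using pos[OF assms(2)] by (simp_all add: zero_less_mult_iff)
    then show ?thesis
      using assms Interior True by (auto simp: edge_point_def min_def abs_if)
  qed (use Interior in \<open>auto simp: edge_point_def\<close>)
qed

text \<open>
  Hence \<open>local_dist\<close> is a potential and bounds the distance from below; inside the star, moving
  straight towards the centre shows that the bound is attained.
\<close>

lemma local_dist_lipschitz:
  assumes x: "star_radius G l \<rho> x" and e: "e \<in> arcs G" "s \<in> {0..1}" "s' \<in> {0..1}"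
  shows "\<bar>local_dist G l \<rho> x (edge_point G e s) - local_dist G l \<rho> x (edge_point G e s')\<bar>
    \<le> l e * \<bar>s - s'\<bar>"
proof -
  have m: "\<bar>min a b - min a' b'\<bar> \<le> d" if "\<bar>a - a'\<bar> \<le> d" "\<bar>b - b'\<bar> \<le> d" for a b a' b' d :: real
    using that by linarith
  have d: "0 \<le> l e * \<bar>s - s'\<bar>" using pos[OF e(1)] by simp
  have d': "\<bar>l e * a - l e * b\<bar> = l e * \<bar>a - b\<bar>" for a b
    using pos[OF e(1)] by (simp add: abs_mult flip: right_diff_distrib)
  have eq: "local_dist G l \<rho> x (edge_point G e a) = (case x of
      Vertex v \<Rightarrow> min \<rho> (min
        (if tail G e = v then l e * a else \<rho>) (if head G e = v then l e * (1 - a) else \<rho>))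
    | Interior e' s' \<Rightarrow> if e' = e then min \<rho> (l e * \<bar>s' - a\<bar>) else \<rho>)" if "a \<in> {0..1}" for a
    using local_dist_edge_point[OF x e(1)] that by simp
  show ?thesis
  proof (cases x)
    case (Vertex v)
    then show ?thesis
      using d d'[of s s'] d'[of "1 - s" "1 - s'"] unfolding eq[OF e(2)] eq[OF e(3)]
      by (simp add: m abs_minus_commute)
  next
    case (Interior e' s0)
    have "l e * \<bar>\<bar>s0 - s\<bar> - \<bar>s0 - s'\<bar>\<bar> \<le> l e * \<bar>s - s'\<bar>"
      using pos[OF e(1)] by (intro mult_left_mono) auto
    then show ?thesis
      using Interior d d'[of "\<bar>s0 - s\<bar>" "\<bar>s0 - s'\<bar>"] unfolding eq[OF e(2)] eq[OF e(3)]
      by (simp add: m)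
  qed
qed

lemma local_dist_self: "star_radius G l \<rho> x \<Longrightarrow> local_dist G l \<rho> x x = 0"
  by (cases x) auto

lemma local_dist_nonneg:
  assumes "star_radius G l \<rho> x" "y \<in> realization G"
  shows "0 \<le> local_dist G l \<rho> x y"
proof -
  have "0 < \<rho>" using star_radius_pos assms by metis
  then show ?thesis
    using assms by (cases x; cases y) (auto simp: less_imp_le pos)
qed

lemma local_dist_eq_0:
  assumes "star_radius G l \<rho> x" "y \<in> realization G" "local_dist G l \<rho> x y = 0"
  shows "y = x"
proof -
  have "0 < \<rho>" using star_radius_pos assms by metis
  then show ?thesis
    using assms by (cases x; cases y) (auto simp: min_def dest: pos split: if_splits)
qed

lemma local_dist_le_dist:
  assumes "star_radius G l \<rho> x" "x \<in> realization G" "y \<in> realization G"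
  shows "local_dist G l \<rho> x y \<le> realization_dist G l x y"
  using dist_ge_potential[of "local_dist G l \<rho> x" x y] local_dist_lipschitz[OF assms(1)]
    local_dist_self[OF assms(1)] local_dist_nonneg[OF assms(1,3)] assms by simp

lemma dist_le_local_dist:
  assumes x: "star_radius G l \<rho> x" "x \<in> realization G" and y: "y \<in> realization G"
    and less: "local_dist G l \<rho> x y < \<rho>"
  shows "realization_dist G l x y \<le> local_dist G l \<rho> x y"
proof (rule dist_le)
  show "route G l x y (local_dist G l \<rho> x y)"
  proof (cases x)
    case x_eq: (Vertex v)
    show ?thesis
    proof (cases y)
      case (Vertex w)
      then show ?thesis using x_eq less route_stay[OF x(2)] by (auto split: if_splits)
    next
      case (Interior e s)
      then have e: "e \<in> arcs G" "0 < s" "s < 1" using y by auto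
      then have *: "tail G e = v \<and> local_dist G l \<rho> x y = l e * \<bar>0 - s\<bar> \<or>
          head G e = v \<and> local_dist G l \<rho> x y = l e * \<bar>1 - s\<bar>"
        using less Interior x_eq by (auto simp: min_def split: if_splits)
      have "edge_point G e s = y" using e Interior by (simp add: edge_point_interior)
      then show ?thesis
        using * route_edge[of e 0 s] route_edge[of e 1 s] e x_eq by auto
    qed
  next
    case x_eq: (Interior e s)
    then obtain s' where y_eq: "y = Interior e s'" using less by (cases y) (auto split: if_splits)
    have "local_dist G l \<rho> x y = l e * \<bar>s - s'\<bar>" using less x_eq y_eq by (auto simp: min_def)
    then show ?thesis
      using route_edge[of e s s'] x_eq y_eq x(2) y by (simp add: edge_point_interior)
  qed
qed

lemma dist_eq_iff_local_dist_eq: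
  assumes "star_radius G l \<rho> x" "x \<in> realization G" "y \<in> realization G" "r < \<rho>"
  shows "realization_dist G l x y = r \<longleftrightarrow> local_dist G l \<rho> x y = r"
  using local_dist_le_dist[OF assms(1-3)] dist_le_local_dist[OF assms(1-3)] assms(4) by linarith

lemma dist_edge_points_le:
  assumes "e \<in> arcs G" "s \<in> {0..1}" "s' \<in> {0..1}"
  shows "realization_dist G l (edge_point G e s) (edge_point G e s') \<le> l e * \<bar>s - s'\<bar>"
  using dist_le[OF route_edge[OF assms]] .

lemma star_radius_exists:
  assumes "x \<in> realization G"
  obtains \<rho> where "star_radius G l \<rho> x"
proof (cases x)
  case (Vertex v)
  have "star_radius G l (Min (insert 1 (l ` arcs G))) x"
    using Vertex pos by (auto simp: finite_arcs)
  then show thesis by (rule that)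
next
  case (Interior e s)
  then have "star_radius G l (min (l e * s) (l e * (1 - s))) x"
    using assms pos by auto
  then show thesis by (rule that)
qed

text \<open>
  The radius stays below half the length of each edge, so that the two points of the sphere on a
  loop at \<open>v\<close>, one near either end, are distinct.
\<close>

lemma vertex_sphere:
  assumes v: "v \<in> verts G" "star_radius G l \<rho> (Vertex v)" and r: "0 < r" "2 * r < \<rho>"
  shows "{y \<in> realization G. realization_dist G l (Vertex v) y = r} =
    (\<lambda>(e, b). Interior e (if b then r / l e else 1 - r / l e)) ` half_edges G v" (is "?S = ?P ` _")
proof
  have eq: "realization_dist G l (Vertex v) y = r \<longleftrightarrow> local_dist G l \<rho> (Vertex v) y = r"
    if "y \<in> realization G" for y
    using dist_eq_iff_local_dist_eq[OF v(2)] v that r by auto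
  show "?S \<subseteq> ?P ` half_edges G v"
  proof
    fix y assume y: "y \<in> ?S"
    then have yr: "local_dist G l \<rho> (Vertex v) y = r" using eq by auto
    then obtain e s where y_eq: "y = Interior e s" using r by (cases y) (auto split: if_splits)
    then have e: "e \<in> arcs G" using y by auto
    have "tail G e = v \<and> l e * s = r \<or> head G e = v \<and> l e * (1 - s) = r"
      using yr y_eq r by (auto simp: min_def split: if_splits)
    then show "y \<in> ?P ` half_edges G v"
    proof
      assume "tail G e = v \<and> l e * s = r"
      then have "(e, True) \<in> half_edges G v" "y = ?P (e, True)"
        using e pos[OF e] y_eq by (auto simp: half_edges_def step_source_def)
      then show ?thesis by blast
    next
      assume "head G e = v \<and> l e * (1 - s) = r"
      then have "(e, False) \<in> half_edges G v" "y = ?P (e, False)"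
        using e pos[OF e] y_eq by (auto simp: half_edges_def step_source_def field_simps)
      then show ?thesis by blast
    qed
  qed
  show "?P ` half_edges G v \<subseteq> ?S"
  proof
    fix y assume "y \<in> ?P ` half_edges G v"
    then obtain e b where eb: "(e, b) \<in> half_edges G v" and y: "y = ?P (e, b)" by auto
    then have e: "e \<in> arcs G" by (simp add: half_edges_def)
    then have "\<rho> \<le> l e" using v(2) by simp
    then have q: "0 < r / l e" "2 * (r / l e) < 1" using r by (auto simp: field_simps)
    have "l e * (r / l e) = r" using pos[OF e] by simp
    moreover have "r < l e * (1 - r / l e)" using pos[OF e] r \<open>\<rho> \<le> l e\<close> by (simp add: algebra_simps)
    ultimately have "local_dist G l \<rho> (Vertex v) y = r"
      using eb y r by (cases b) (auto simp: half_edges_def step_source_def min_def)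
    moreover have "y \<in> realization G" using y e q by (auto split: if_splits)
    ultimately show "y \<in> ?S" using eq by auto
  qed
qed

lemma interior_sphere:
  assumes x: "Interior e s \<in> realization G" "star_radius G l \<rho> (Interior e s)"
    and r: "0 < r" "2 * r < \<rho>"
  shows "{y \<in> realization G. realization_dist G l (Interior e s) y = r} =
    {Interior e (s - r / l e), Interior e (s + r / l e)}" (is "?S = _")
proof -
  have e: "e \<in> arcs G" "0 < s" "s < 1" using x by auto
  have le: "0 < l e" using pos e by auto
  have q: "0 < r / l e" using le r by simp
  have in_edge: "0 < s - r / l e" "s + r / l e < 1"
    using x(2) r le by (auto simp: field_simps)
  have "y \<in> ?S \<longleftrightarrow> y = Interior e (s - r / l e) \<or> y = Interior e (s + r / l e)"
    if y: "y \<in> realization G" for y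
  proof -
    have "y \<in> ?S \<longleftrightarrow> local_dist G l \<rho> (Interior e s) y = r"
      using dist_eq_iff_local_dist_eq[OF x(2,1) y, of r] y r by auto
    also have "\<dots> \<longleftrightarrow> (\<exists>s'. y = Interior e s' \<and> l e * \<bar>s - s'\<bar> = r)"
      using r by (cases y) (auto simp: min_def)
    also have "\<dots> \<longleftrightarrow> (\<exists>s'. y = Interior e s' \<and> \<bar>s - s'\<bar> = r / l e)"
      using le by (simp add: field_simps)
    also have "\<dots> \<longleftrightarrow> y = Interior e (s - r / l e) \<or> y = Interior e (s + r / l e)"
    proof -
      have "\<bar>s - s'\<bar> = q \<longleftrightarrow> s' = s - q \<or> s' = s + q" if "0 < q" for s' q
        using that by (auto simp: abs_if)
      moreover have "0 < r / l e" using r le by simp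
      ultimately show ?thesis by auto
    qed
    finally show ?thesis .
  qed
  moreover have "Interior e (s - r / l e) \<in> realization G" "Interior e (s + r / l e) \<in> realization G"
    using in_edge e q by auto
  ultimately show ?thesis by blast
qed

text \<open>Small spheres count directions, so the valency of a point is a metric invariant.\<close>

lemma card_sphere:
  assumes x: "x \<in> realization G" "star_radius G l \<rho> x" and r: "0 < r" "2 * r < \<rho>"
  shows "card {y \<in> realization G. realization_dist G l x y = r} = point_valency G x"
proof (cases x)
  case (Vertex v)
  have q: "2 * (r / l e) < 1" if "e \<in> arcs G" for e
  proof -
    have "\<rho> \<le> l e" using x(2) Vertex that by auto
    then show ?thesis using r pos[OF that] by (simp add: field_simps)
  qed
  have "inj_on (\<lambda>(e, b). Interior e (if b then r / l e else 1 - r / l e) :: ('v, 'e) point) (half_edges G v)"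
    using q by (fastforce simp: inj_on_def half_edges_def split: if_splits)
  then show ?thesis
    using vertex_sphere[of v \<rho> r] x r Vertex
    by (simp add: card_image card_half_edges finite_arcs)
next
  case (Interior e s)
  then have "r / l e > 0" using x(1) r pos by simp
  then have "s - r / l e \<noteq> s + r / l e" by linarith
  then show ?thesis
    using interior_sphere[of e s \<rho> r] x r Interior by simp
qed

end


section \<open>Isometries are combinatorial isomorphisms\<close>

lemma locally_constant_on_interval:
  fixes f :: "real \<Rightarrow> 'a"
  assumes "\<And>s. s \<in> {0<..<1} \<Longrightarrow> \<exists>d > 0. \<forall>t \<in> {0<..<1}. \<bar>t - s\<bar> < d \<longrightarrow> f t = f s"
    and "s \<in> {0<..<1}" "t \<in> {0<..<1}"
  shows "f s = f t"
proof -
  have "f constant_on {0<..<1::real}"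
  proof (rule locally_constant_imp_constant)
    fix a :: real assume a: "a \<in> {0<..<1}"
    with assms(1) obtain d where d: "d > 0" "\<forall>t \<in> {0<..<1}. \<bar>t - a\<bar> < d \<longrightarrow> f t = f a" by blast
    have "openin (top_of_set {0<..<1}) ({0<..<1} \<inter> ball a d)" by (rule openin_open_Int) simp
    moreover have "a \<in> {0<..<1} \<inter> ball a d" using a d(1) by simp
    moreover have "f x = f a" if "x \<in> {0<..<1} \<inter> ball a d" for x
    proof -
      have "x \<in> {0<..<1}" "\<bar>x - a\<bar> < d" using that by (simp_all add: dist_real_def abs_minus_commute)
      with d(2) show ?thesis by blast
    qed
    ultimately show "\<exists>T. openin (top_of_set {0<..<1}) T \<and> a \<in> T \<and> (\<forall>x \<in> T. f x = f a)" by blast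
  qed simp
  then show ?thesis using assms(2,3) by (auto simp: constant_on_def)
qed

text \<open>
  An injective continuous function on an interval is monotone, which excludes a change of the
  sign of the slope.
\<close>

lemma locally_similar_imp_affine:
  fixes u :: "real \<Rightarrow> real"
  assumes c: "c > 0" and inj: "inj_on u {0<..<1}"
    and loc: "\<And>s. s \<in> {0<..<1} \<Longrightarrow>
      \<exists>d > 0. \<forall>t \<in> {0<..<1}. \<bar>t - s\<bar> < d \<longrightarrow> \<bar>u t - u s\<bar> = c * \<bar>t - s\<bar>"
  obtains a \<sigma> where "\<sigma> = 1 \<or> \<sigma> = - 1" "\<And>s. s \<in> {0<..<1} \<Longrightarrow> u s = a + \<sigma> * (c * s)"
proof -
  have "continuous_on {0<..<1} u"
    unfolding continuous_on_iff
  proof (intro ballI allI impI)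
    fix s \<epsilon> :: real assume s: "s \<in> {0<..<1}" and "0 < \<epsilon>"
    from loc[OF s] obtain d where d: "d > 0"
      "\<forall>t \<in> {0<..<1}. \<bar>t - s\<bar> < d \<longrightarrow> \<bar>u t - u s\<bar> = c * \<bar>t - s\<bar>" by blast
    have "\<forall>t \<in> {0<..<1}. dist t s < min d (\<epsilon> / c) \<longrightarrow> dist (u t) (u s) < \<epsilon>"
      using d c by (auto simp: dist_real_def field_simps)
    then show "\<exists>\<delta> > 0. \<forall>t \<in> {0<..<1}. dist t s < \<delta> \<longrightarrow> dist (u t) (u s) < \<epsilon>"
      using d(1) c \<open>0 < \<epsilon>\<close> by (intro exI[of _ "min d (\<epsilon> / c)"]) auto
  qed
  then have "strict_mono_on {0<..<1} u \<or> strict_antimono_on {0<..<1} u"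
    using inj injective_eq_monotone_map[of "{0<..<1}" u] by (auto simp: is_interval_oo)
  then obtain \<sigma> where \<sigma>: "\<sigma> = 1 \<or> \<sigma> = (- 1 :: real)"
    and mono: "\<And>s t. \<lbrakk>s \<in> {0<..<1}; t \<in> {0<..<1}; s < t\<rbrakk> \<Longrightarrow> 0 < \<sigma> * (u t - u s)"
  proof
    assume m: "strict_mono_on {0<..<1} u"
    show thesis by (rule that[of 1]) (use m in \<open>auto simp: monotone_on_def\<close>)
  next
    assume m: "strict_antimono_on {0<..<1} u"
    show thesis by (rule that[of "- 1"]) (use m in \<open>auto simp: monotone_on_def\<close>)
  qed
  have "u s - \<sigma> * (c * s) = u t - \<sigma> * (c * t)" if "s \<in> {0<..<1}" "t \<in> {0<..<1}" for s t
  proof (rule locally_constant_on_interval[OF _ that])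
    fix s :: real assume s: "s \<in> {0<..<1}"
    from loc[OF s] obtain d where d: "d > 0"
      "\<forall>t \<in> {0<..<1}. \<bar>t - s\<bar> < d \<longrightarrow> \<bar>u t - u s\<bar> = c * \<bar>t - s\<bar>" by blast
    have "u t - \<sigma> * (c * t) = u s - \<sigma> * (c * s)" if t: "t \<in> {0<..<1}" "\<bar>t - s\<bar> < d" for t
    proof -
      have abs: "\<bar>u t - u s\<bar> = c * \<bar>t - s\<bar>" using d t by blast
      have "u t - u s = \<sigma> * (c * (t - s))"
      proof (cases s t rule: linorder_cases)
        case less
        then show ?thesis using mono[OF s t(1)] abs \<sigma> by auto
      next
        case greater
        then have "\<bar>t - s\<bar> = s - t" by simp
        then have "\<bar>u t - u s\<bar> = c * (s - t)" using abs by simp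
        then show ?thesis using mono[OF t(1) s greater] \<sigma> by (auto simp: algebra_simps)
      qed simp
      then show ?thesis by (simp add: algebra_simps)
    qed
    with d(1) show "\<exists>d > 0. \<forall>t \<in> {0<..<1}. \<bar>t - s\<bar> < d \<longrightarrow>
        u t - \<sigma> * (c * t) = u s - \<sigma> * (c * s)" by blast
  qed
  from this[of _ "1 / 2"] have "u s = (u (1 / 2) - \<sigma> * (c * (1 / 2))) + \<sigma> * (c * s)"
    if "s \<in> {0<..<1}" for s
    using that by force
  with \<sigma> show thesis by (rule that)
qed

text \<open>
  The flag allows the orientation to be reversed, since orientations only serve to parametrize edges.
\<close>

definition maps_edge :: "('v, 'e) pre_digraph \<Rightarrow> ('w, 'f) pre_digraph \<Rightarrow>
    (('v, 'e) point \<Rightarrow> ('w, 'f) point) \<Rightarrow> 'e \<Rightarrow> 'f \<Rightarrow> bool" where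
  "maps_edge G G' f e e' \<longleftrightarrow> (\<exists>b. \<forall>s \<in> {0..1}.
     f (edge_point G e s) = edge_point G' e' (if b then s else 1 - s))"

lemma realization_isometry_inv:
  assumes "realization_isometry G l G' l' f"
  shows "realization_isometry G' l' G l (inv_into (realization G) f)"
proof -
  have bij: "bij_betw f (realization G) (realization G')"
    using assms by (simp add: realization_isometry_def)
  have g: "inv_into (realization G) f y \<in> realization G" "f (inv_into (realization G) f y) = y"
    if "y \<in> realization G'" for y
    using bij_betw_apply[OF bij_betw_inv_into[OF bij] that] bij_betw_inv_into_right[OF bij that] by auto
  have "realization_dist G l (inv_into (realization G) f x) (inv_into (realization G) f y) =
      realization_dist G' l' x y" if "x \<in> realization G'" "y \<in> realization G'" for x y
    using assms g[OF that(1)] g[OF that(2)] unfolding realization_isometry_def by metis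
  then show ?thesis
    using bij_betw_inv_into[OF bij] by (simp add: realization_isometry_def)
qed

text \<open>
  An isometry maps spheres to spheres, and spheres that are small around both points count the
  directions there.
\<close>

lemma point_valency_isometry:
  assumes "metric_graph G l" "metric_graph G' l'" and iso: "realization_isometry G l G' l' f"
    and x: "x \<in> realization G"
  shows "point_valency G' (f x) = point_valency G x"
proof -
  interpret A: metric_graph G l by fact
  interpret B: metric_graph G' l' by fact
  have bij: "bij_betw f (realization G) (realization G')"
    and dist: "\<And>y. y \<in> realization G \<Longrightarrow>
      realization_dist G' l' (f x) (f y) = realization_dist G l x y"
    using iso x by (auto simp: realization_isometry_def)
  have fx: "f x \<in> realization G'" using bij x by (rule bij_betw_apply)
  obtain \<rho> where \<rho>: "star_radius G l \<rho> x" using A.star_radius_exists[OF x] .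
  obtain \<rho>' where \<rho>': "star_radius G' l' \<rho>' (f x)" using B.star_radius_exists[OF fx] .
  \<comment> \<open>Any radius below half of both star radii would do.\<close>
  define r where "r = min \<rho> \<rho>' / 3"
  have r: "0 < r" "2 * r < \<rho>" "2 * r < \<rho>'"
    using star_radius_pos[OF \<rho>] star_radius_pos[OF \<rho>'] by (auto simp: r_def)
  let ?S = "{y \<in> realization G. realization_dist G l x y = r}"
  have "{y \<in> realization G'. realization_dist G' l' (f x) y = r} = f ` ?S"
  proof -
    have "realization G' = f ` realization G" using bij by (simp add: bij_betw_def)
    then show ?thesis using dist by auto
  qed
  moreover have "inj_on f ?S"
    using bij by (auto simp: bij_betw_def intro: inj_on_subset)
  ultimately show ?thesis
    using A.card_sphere[OF x \<rho> r(1,2)] B.card_sphere[OF fx \<rho>' r(1,3)] by (simp add: card_image)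
qed

text \<open>
  Where every vertex has valency at least 3, the vertices are recognized by the metric as the points
  whose valency is not 2.
\<close>

locale branched_isometry = A: metric_graph G l + B: metric_graph G' l'
  for G :: "('v, 'e) pre_digraph" and l and G' :: "('w, 'f) pre_digraph" and l' +
  fixes f :: "('v, 'e) point \<Rightarrow> ('w, 'f) point"
  assumes iso: "realization_isometry G l G' l' f"
    and branching: "v \<in> verts G \<Longrightarrow> valency G v \<ge> 3" "w \<in> verts G' \<Longrightarrow> valency G' w \<ge> 3"
begin

lemma bij: "bij_betw f (realization G) (realization G')"
  using iso by (simp add: realization_isometry_def)

lemma inverse: "branched_isometry G' l' G l (inv_into (realization G) f)"
  by (intro branched_isometry.intro branched_isometry_axioms.intro realization_isometry_inv iso
      A.metric_graph_axioms B.metric_graph_axioms branching)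

lemma image_in: "x \<in> realization G \<Longrightarrow> f x \<in> realization G'"
  using bij by (rule bij_betw_apply)

lemma dist_image: "\<lbrakk>x \<in> realization G; y \<in> realization G\<rbrakk> \<Longrightarrow>
    realization_dist G' l' (f x) (f y) = realization_dist G l x y"
  using iso by (simp add: realization_isometry_def)

lemma point_valency_image: "x \<in> realization G \<Longrightarrow> point_valency G' (f x) = point_valency G x"
  using point_valency_isometry[OF A.metric_graph_axioms B.metric_graph_axioms iso] .

lemma image_interior:
  assumes "Interior e s \<in> realization G"
  obtains e' s' where "f (Interior e s) = Interior e' s'" "e' \<in> arcs G'" "s' \<in> {0<..<1}"
proof -
  have "point_valency G' (f (Interior e s)) = 2" using point_valency_image[OF assms] by simp
  then show thesis
    using image_in[OF assms] branching(2) that by (cases "f (Interior e s)") force+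
qed

text \<open>
  Around an interior point both metrics are those of intervals, so \<open>f\<close> is locally an isometry of
  intervals.
\<close>

lemma image_edge_local:
  assumes e: "e \<in> arcs G" and s: "s \<in> {0<..<1}" and fs: "f (Interior e s) = Interior e' u"
  obtains d where "d > 0" "\<And>t. \<lbrakk>t \<in> {0<..<1}; \<bar>t - s\<bar> < d\<rbrakk> \<Longrightarrow>
    \<exists>u'. f (Interior e t) = Interior e' u' \<and> l' e' * \<bar>u' - u\<bar> = l e * \<bar>t - s\<bar>"
proof -
  have x: "Interior e s \<in> realization G" using e s by simp
  have y: "Interior e' u \<in> realization G'" using image_in[OF x] fs by simp
  obtain \<rho> where \<rho>: "star_radius G l \<rho> (Interior e s)" using A.star_radius_exists[OF x] .
  obtain \<rho>' where \<rho>': "star_radius G' l' \<rho>' (Interior e' u)" using B.star_radius_exists[OF y] .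
  have le: "0 < l e" using A.pos[OF e] .
  show thesis
  proof (rule that)
    show "0 < min \<rho> \<rho>' / l e"
      using star_radius_pos[OF \<rho>] star_radius_pos[OF \<rho>'] le by simp
    fix t assume t: "t \<in> {0<..<1}" "\<bar>t - s\<bar> < min \<rho> \<rho>' / l e"
    have z: "Interior e t \<in> realization G" using e t by simp
    have r: "l e * \<bar>t - s\<bar> < \<rho>" "l e * \<bar>t - s\<bar> < \<rho>'" using t(2) le by (auto simp: field_simps)
    then have "local_dist G l \<rho> (Interior e s) (Interior e t) = l e * \<bar>t - s\<bar>"
      by (simp add: abs_minus_commute)
    then have "realization_dist G l (Interior e s) (Interior e t) = l e * \<bar>t - s\<bar>"
      using A.dist_eq_iff_local_dist_eq[OF \<rho> x z r(1)] by simp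
    then have "realization_dist G' l' (Interior e' u) (f (Interior e t)) = l e * \<bar>t - s\<bar>"
      using dist_image[OF x z] fs by simp
    then have "local_dist G' l' \<rho>' (Interior e' u) (f (Interior e t)) = l e * \<bar>t - s\<bar>"
      using B.dist_eq_iff_local_dist_eq[OF \<rho>' y image_in[OF z] r(2)] by simp
    then show "\<exists>u'. f (Interior e t) = Interior e' u' \<and> l' e' * \<bar>u' - u\<bar> = l e * \<bar>t - s\<bar>"
      using r(2) by (cases "f (Interior e t)") (auto simp: min_def abs_minus_commute split: if_splits)
  qed
qed

text \<open>
  The edge that contains the image of a point of \<open>e\<close> is locally constant along \<open>e\<close>, hence constant,
  and the parameter on it is locally a similarity with ratio \<open>l e / l' e'\<close>.
\<close>

lemma image_edge_affine:
  assumes e: "e \<in> arcs G"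
  obtains e' a \<sigma> where "e' \<in> arcs G'" "\<sigma> = 1 \<or> \<sigma> = - 1"
    "\<And>s. s \<in> {0<..<1} \<Longrightarrow> f (Interior e s) = Interior e' (a + \<sigma> * (l e / l' e' * s)) \<and>
       a + \<sigma> * (l e / l' e' * s) \<in> {0<..<1}"
proof -
  have "\<forall>s. \<exists>e' u. s \<in> {0<..<1} \<longrightarrow> f (Interior e s) = Interior e' u \<and> e' \<in> arcs G' \<and> u \<in> {0<..<1}"
    using e image_interior[of e] by (metis greaterThanLessThan_iff interior_in_realization)
  then obtain E U where EU: "\<And>s. s \<in> {0<..<1} \<Longrightarrow> f (Interior e s) = Interior (E s) (U s)"
    and E_in: "\<And>s. s \<in> {0<..<1} \<Longrightarrow> E s \<in> arcs G'" and U_in: "\<And>s. s \<in> {0<..<1} \<Longrightarrow> U s \<in> {0<..<1}"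
    by metis
  have E_const: "E s = E t" if "s \<in> {0<..<1}" "t \<in> {0<..<1}" for s t
  proof (rule locally_constant_on_interval[OF _ that])
    fix s :: real assume s: "s \<in> {0<..<1}"
    from image_edge_local[OF e s EU[OF s]] obtain d where d: "d > 0"
      "\<And>t. \<lbrakk>t \<in> {0<..<1}; \<bar>t - s\<bar> < d\<rbrakk> \<Longrightarrow> \<exists>u'. f (Interior e t) = Interior (E s) u'"
      by metis
    then have "\<forall>t \<in> {0<..<1}. \<bar>t - s\<bar> < d \<longrightarrow> E t = E s" using EU by fastforce
    with d(1) show "\<exists>d > 0. \<forall>t \<in> {0<..<1}. \<bar>t - s\<bar> < d \<longrightarrow> E t = E s" by blast
  qed
  define e' where "e' = E (1 / 2)"
  have E: "E s = e'" if "s \<in> {0<..<1}" for s using E_const[OF that, of "1 / 2"] by (simp add: e'_def)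
  have e': "e' \<in> arcs G'" using E_in[of "1 / 2"] by (simp add: e'_def)
  have l': "0 < l' e'" using B.pos[OF e'] .
  have "inj_on U {0<..<1}"
  proof (rule inj_onI)
    fix s t assume st: "s \<in> {0<..<1}" "t \<in> {0<..<1}" "U s = U t"
    then have "f (Interior e s) = f (Interior e t)" using EU E by simp
    then have "Interior e s = (Interior e t :: ('v, 'e) point)"
      using bij_betw_imp_inj_on[OF bij] st e by (auto dest: inj_onD)
    then show "s = t" by simp
  qed
  moreover have "\<exists>d > 0. \<forall>t \<in> {0<..<1}. \<bar>t - s\<bar> < d \<longrightarrow> \<bar>U t - U s\<bar> = l e / l' e' * \<bar>t - s\<bar>"
    if s: "s \<in> {0<..<1}" for s
  proof -
    have "f (Interior e s) = Interior e' (U s)" using EU[OF s] E[OF s] by simp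
    from image_edge_local[OF e s this] obtain d where d: "d > 0"
      "\<And>t. \<lbrakk>t \<in> {0<..<1}; \<bar>t - s\<bar> < d\<rbrakk> \<Longrightarrow>
         \<exists>u'. f (Interior e t) = Interior e' u' \<and> l' e' * \<bar>u' - U s\<bar> = l e * \<bar>t - s\<bar>"
      by metis
    then have "\<forall>t \<in> {0<..<1}. \<bar>t - s\<bar> < d \<longrightarrow> l' e' * \<bar>U t - U s\<bar> = l e * \<bar>t - s\<bar>"
      using EU by fastforce
    then have "\<forall>t \<in> {0<..<1}. \<bar>t - s\<bar> < d \<longrightarrow> \<bar>U t - U s\<bar> = l e / l' e' * \<bar>t - s\<bar>"
      using l' by (simp add: field_simps)
    with d(1) show ?thesis by blast
  qed
  moreover have "0 < l e / l' e'" using A.pos[OF e] l' by simp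
  ultimately obtain a \<sigma> where a: "\<sigma> = 1 \<or> \<sigma> = - 1"
      "\<And>s. s \<in> {0<..<1} \<Longrightarrow> U s = a + \<sigma> * (l e / l' e' * s)"
    using locally_similar_imp_affine by metis
  show thesis
    by (rule that[OF e' a(1)]) (use EU E U_in a(2) in fastforce)
qed

end

text \<open>
  Points near the two ends of the unit interval have images less than 1 apart. For an isometry and its
  inverse this bounds the ratio of the lengths of an edge and its image in both directions.
\<close>

lemma affine_unit_interval_slope:
  fixes a \<sigma> c :: real
  assumes \<sigma>: "\<sigma> = 1 \<or> \<sigma> = - 1" and unit: "\<And>s. s \<in> {0<..<1} \<Longrightarrow> a + \<sigma> * (c * s) \<in> {0<..<1}"
  shows "c \<le> 1"
proof (rule ccontr)
  assume c: "\<not> c \<le> 1"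
  \<comment> \<open>Points at distance \<open>1 - \<delta>\<close> would have images at distance \<open>c * (1 - \<delta>) = (c + 1) / 2 > 1\<close>.\<close>
  define \<delta> where "\<delta> = (c - 1) / (2 * c)"
  have \<delta>: "0 < \<delta>" "\<delta> < 1" "c * \<delta> = (c - 1) / 2" using c by (auto simp: \<delta>_def field_simps)
  have "c * (1 - \<delta> / 2) - c * (\<delta> / 2) > 1" using \<delta>(3) c by (simp add: algebra_simps)
  moreover have "a + \<sigma> * (c * (\<delta> / 2)) \<in> {0<..<1}" "a + \<sigma> * (c * (1 - \<delta> / 2)) \<in> {0<..<1}"
    by (rule unit; use \<delta> in simp)+
  ultimately show False using \<sigma> by auto
qed

text \<open>
  Letting the argument tend to the ends of the unit interval determines the constant term.
\<close>

lemma affine_unit_interval_onto: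
  fixes a \<sigma> :: real
  assumes \<sigma>: "\<sigma> = 1 \<or> \<sigma> = - 1" and unit: "\<And>s. s \<in> {0<..<1} \<Longrightarrow> a + \<sigma> * s \<in> {0<..<1}"
  shows "a = (if \<sigma> = 1 then 0 else 1)"
proof -
  have "\<bar>a - (if \<sigma> = 1 then 0 else 1)\<bar> \<le> \<delta>" if "0 < \<delta>" for \<delta>
  proof -
    define s where "s = min \<delta> 1 / 2"
    have "s \<in> {0<..<1}" "1 - s \<in> {0<..<1}" "s < \<delta>" using that by (auto simp: s_def)
    then show ?thesis using unit[of s] unit[of "1 - s"] \<sigma> by auto
  qed
  from field_le_epsilon[of "\<bar>a - (if \<sigma> = 1 then 0 else 1)\<bar>" 0] this show ?thesis by force
qed

context branched_isometry
begin

lemma image_edge_length_le: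
  assumes e: "e \<in> arcs G"
  obtains e' where "e' \<in> arcs G'" "l e \<le> l' e'"
    "\<And>s. s \<in> {0<..<1} \<Longrightarrow> \<exists>u \<in> {0<..<1}. f (Interior e s) = Interior e' u"
    "l e = l' e' \<Longrightarrow> \<exists>b. \<forall>s \<in> {0<..<1}. f (Interior e s) = Interior e' (if b then s else 1 - s)"
proof -
  from image_edge_affine[OF e] obtain e' a \<sigma> where *: "e' \<in> arcs G'" "\<sigma> = 1 \<or> \<sigma> = - 1"
    and f: "\<And>s. s \<in> {0<..<1} \<Longrightarrow> f (Interior e s) = Interior e' (a + \<sigma> * (l e / l' e' * s))"
    and unit: "\<And>s. s \<in> {0<..<1} \<Longrightarrow> a + \<sigma> * (l e / l' e' * s) \<in> {0<..<1}"
    by metis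
  have l': "0 < l' e'" using B.pos[OF *(1)] .
  show thesis
  proof (rule that[OF *(1)])
    show "l e \<le> l' e'" using affine_unit_interval_slope[OF *(2) unit] l' by (simp add: field_simps)
    show "\<exists>u \<in> {0<..<1}. f (Interior e s) = Interior e' u" if "s \<in> {0<..<1}" for s
      using f[OF that] unit[OF that] by blast
    assume "l e = l' e'"
    then have one: "l e / l' e' = 1" using l' by simp
    then have "a = (if \<sigma> = 1 then 0 else 1)"
      using affine_unit_interval_onto[OF *(2), of a] unit by simp
    then have "\<forall>s \<in> {0<..<1}. f (Interior e s) = Interior e' (if \<sigma> = 1 then s else 1 - s)"
      using f *(2) unfolding one by (auto split: if_splits)
    then show "\<exists>b. \<forall>s \<in> {0<..<1}. f (Interior e s) = Interior e' (if b then s else 1 - s)"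
      by (intro exI[of _ "\<sigma> = 1"])
  qed
qed

text \<open>
  The end of the image edge is at distance 0 from the image of the end, by approximating the end
  from the interior.
\<close>

lemma image_edge_end:
  assumes e: "e \<in> arcs G" and e': "e' \<in> arcs G'" and len: "l e = l' e'"
    and f: "\<And>s. s \<in> {0<..<1} \<Longrightarrow> f (Interior e s) = Interior e' (if b then s else 1 - s)"
    and s0: "s0 = 0 \<or> s0 = 1"
  shows "f (edge_point G e s0) = edge_point G' e' (if b then s0 else 1 - s0)"
proof -
  let ?\<sigma> = "\<lambda>s :: real. if b then s else 1 - s"
  have x: "edge_point G e s0 \<in> realization G" using s0 by (intro A.edge_point_in e) auto
  have y: "edge_point G' e' (?\<sigma> s0) \<in> realization G'" using s0 by (intro B.edge_point_in e') auto
  obtain \<rho> where \<rho>: "star_radius G' l' \<rho> (f (edge_point G e s0))"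
    using B.star_radius_exists[OF image_in[OF x]] .
  let ?h = "\<lambda>z. local_dist G' l' \<rho> (f (edge_point G e s0)) z"
  have "?h (edge_point G' e' (?\<sigma> s0)) \<le> 0 + \<epsilon>" if "0 < \<epsilon>" for \<epsilon>
  proof -
    have le: "0 < l e" using A.pos[OF e] .
    \<comment> \<open>Moving by \<open>d\<close> from the end changes both sides by at most \<open>l e * d\<close>, in total at most \<open>\<epsilon>\<close>.\<close>
    define d where "d = min (1 / 2) (\<epsilon> / (2 * l e))"
    define s where "s = (if s0 = 0 then d else 1 - d)"
    have d: "0 < d" "d < 1" "2 * l e * d \<le> \<epsilon>"
    proof -
      show "0 < d" "d < 1" using that le by (auto simp: d_def)
      have "d \<le> \<epsilon> / (2 * l e)" by (simp add: d_def)
      then show "2 * l e * d \<le> \<epsilon>" using le by (simp add: field_simps)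
    qed
    have s: "s \<in> {0<..<1}" "\<bar>s0 - s\<bar> = d" using d s0 by (auto simp: s_def)
    have \<sigma>s: "?\<sigma> s \<in> {0<..<1}" using s by auto
    have z: "edge_point G e s \<in> realization G" using s by (intro A.edge_point_in e) auto
    have "f (edge_point G e s) = edge_point G' e' (?\<sigma> s)"
      using f[OF s(1)] s(1) \<sigma>s by (simp add: edge_point_interior)
    then have "?h (edge_point G' e' (?\<sigma> s)) \<le> realization_dist G l (edge_point G e s0) (edge_point G e s)"
      using B.local_dist_le_dist[OF \<rho> image_in[OF x] image_in[OF z]] dist_image[OF x z] by simp
    also have "\<dots> \<le> l e * \<bar>s0 - s\<bar>"
      using s s0 by (intro A.dist_edge_points_le e) auto
    finally have 1: "?h (edge_point G' e' (?\<sigma> s)) \<le> l e * d" using s(2) by simp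
    have "\<bar>?h (edge_point G' e' (?\<sigma> s0)) - ?h (edge_point G' e' (?\<sigma> s))\<bar>
        \<le> l' e' * \<bar>?\<sigma> s0 - ?\<sigma> s\<bar>"
    proof (rule B.local_dist_lipschitz[OF \<rho> e'])
      show "?\<sigma> s0 \<in> {0..1}" using s0 by auto
      show "?\<sigma> s \<in> {0..1}" using \<sigma>s by simp
    qed
    also have "\<bar>?\<sigma> s0 - ?\<sigma> s\<bar> = d" using s(2) by (cases b) simp_all
    finally have "?h (edge_point G' e' (?\<sigma> s0)) - ?h (edge_point G' e' (?\<sigma> s)) \<le> l e * d"
      unfolding len by (rule order_trans[OF abs_ge_self])
    from add_mono[OF this 1] d(3) show ?thesis by (simp add: algebra_simps)
  qed
  then have "?h (edge_point G' e' (?\<sigma> s0)) \<le> 0" by (rule field_le_epsilon)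
  with B.local_dist_nonneg[OF \<rho> y] have "?h (edge_point G' e' (?\<sigma> s0)) = 0" by linarith
  with B.local_dist_eq_0[OF \<rho> y] show ?thesis by simp
qed

text \<open>
  The isometry does not map an edge into a shorter one, and neither does its inverse; so an edge and
  its image are equally long, and the affine map between them is onto.
\<close>

lemma maps_edge_exists:
  assumes e: "e \<in> arcs G"
  shows "\<exists>e' \<in> arcs G'. l' e' = l e \<and> maps_edge G G' f e e'"
proof -
  interpret inv: branched_isometry G' l' G l "inv_into (realization G) f" by (rule inverse)
  obtain e' where e': "e' \<in> arcs G'" "l e \<le> l' e'"
    "\<And>s. s \<in> {0<..<1} \<Longrightarrow> \<exists>u \<in> {0<..<1}. f (Interior e s) = Interior e' u"
    "l e = l' e' \<Longrightarrow> \<exists>b. \<forall>s \<in> {0<..<1}. f (Interior e s) = Interior e' (if b then s else 1 - s)"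
    by (rule image_edge_length_le[OF e]) blast
  obtain e2 where e2: "e2 \<in> arcs G" "l' e' \<le> l e2"
    "\<And>s. s \<in> {0<..<1} \<Longrightarrow> \<exists>u \<in> {0<..<1}. inv_into (realization G) f (Interior e' s) = Interior e2 u"
    by (rule inv.image_edge_length_le[OF e'(1)]) blast
  obtain u where u: "u \<in> {0<..<1}" "f (Interior e (1 / 2)) = Interior e' u"
    using e'(3)[of "1 / 2"] by auto
  have "inv_into (realization G) f (f (Interior e (1 / 2))) = Interior e (1 / 2)"
    using bij e by (intro bij_betw_inv_into_left[OF bij]) auto
  then have "e2 = e" using e2(3)[OF u(1)] u(2) by auto
  then have len: "l e = l' e'" using e'(2) e2(2) by simp
  from e'(4)[OF len] obtain b
    where b: "\<And>s. s \<in> {0<..<1} \<Longrightarrow> f (Interior e s) = Interior e' (if b then s else 1 - s)" by blast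
  have "f (edge_point G e s) = edge_point G' e' (if b then s else 1 - s)" if "s \<in> {0..1}" for s
  proof (cases "s = 0 \<or> s = 1")
    case True
    show ?thesis by (rule image_edge_end[OF e e'(1) len b True])
  next
    case False
    with that have "s \<in> {0<..<1}" by auto
    then show ?thesis using b[of s] by (auto simp: edge_point_interior)
  qed
  then show ?thesis using e'(1) len by (auto simp: maps_edge_def)
qed

end


section \<open>Isometries commute with the deformation\<close>

lemma maps_edge_inv:
  assumes bij: "bij_betw f (realization G) (realization G')" and wf: "wf_digraph G"
    and e: "e \<in> arcs G" and f: "maps_edge G G' f e e'"
  shows "maps_edge G' G (inv_into (realization G) f) e' e"
proof -
  from f obtain b where b: "\<And>s. s \<in> {0..1} \<Longrightarrow>
      f (edge_point G e s) = edge_point G' e' (if b then s else 1 - s)"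
    unfolding maps_edge_def by blast
  have "inv_into (realization G) f (edge_point G' e' s) = edge_point G e (if b then s else 1 - s)"
    if s: "s \<in> {0..1}" for s
  proof -
    let ?s = "if b then s else 1 - s"
    have s': "?s \<in> {0..1}" using s by auto
    have "f (edge_point G e ?s) = edge_point G' e' s" using b[OF s'] by (cases b) auto
    then show ?thesis
      using bij_betw_inv_into_left[OF bij edge_point_in_realization[OF wf e s']] by simp
  qed
  then show ?thesis unfolding maps_edge_def by blast
qed

locale combinatorial_iso =
  fixes G :: "('v, 'e) pre_digraph" and G' :: "('w, 'f) pre_digraph"
    and f :: "('v, 'e) point \<Rightarrow> ('w, 'f) point" and \<phi> :: "'e \<Rightarrow> 'f"
  assumes fin: "fin_digraph G" "fin_digraph G'"
    and bij_points: "bij_betw f (realization G) (realization G')"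
    and bij_arcs: "bij_betw \<phi> (arcs G) (arcs G')"
    and maps_edge: "e \<in> arcs G \<Longrightarrow> maps_edge G G' f e (\<phi> e)"
begin

sublocale A: fin_digraph G by (rule fin)
sublocale B: fin_digraph G' by (rule fin)

lemma arc_image: "e \<in> arcs G \<Longrightarrow> \<phi> e \<in> arcs G'"
  using bij_arcs by (rule bij_betw_apply)

lemma inverse: "combinatorial_iso G' G (inv_into (realization G) f) (inv_into (arcs G) \<phi>)"
proof
  show "bij_betw (inv_into (realization G) f) (realization G') (realization G)"
    using bij_points by (rule bij_betw_inv_into)
  show "bij_betw (inv_into (arcs G) \<phi>) (arcs G') (arcs G)"
    using bij_arcs by (rule bij_betw_inv_into)
  fix e' assume e': "e' \<in> arcs G'"
  then have e: "inv_into (arcs G) \<phi> e' \<in> arcs G" "\<phi> (inv_into (arcs G) \<phi> e') = e'"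
    using bij_betwE[OF bij_betw_inv_into[OF bij_arcs]] bij_betw_inv_into_right[OF bij_arcs] by auto
  show "maps_edge G' G (inv_into (realization G) f) e' (inv_into (arcs G) \<phi> e')"
    using maps_edge_inv[OF bij_points A.wf_digraph_axioms e(1)] maps_edge[OF e(1)] e(2) by simp
qed

text \<open>
  This holds for every pair of length functions that correspond under \<open>\<phi>\<close>, in particular for the
  deformed ones.
\<close>

lemma route_image:
  assumes "route G k x y r" and k: "\<And>e. e \<in> arcs G \<Longrightarrow> k' (\<phi> e) = k e"
  shows "route G' k' (f x) (f y) r"
  using assms(1)
proof (induction rule: route.induct)
  case (route_stay x)
  then show ?case using bij_betwE[OF bij_points] route.route_stay by blast
next
  case (route_move e s s' y r)
  obtain b where b: "\<And>s. s \<in> {0..1} \<Longrightarrow>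
      f (edge_point G e s) = edge_point G' (\<phi> e) (if b then s else 1 - s)"
    using maps_edge[OF route_move(1)] unfolding maps_edge_def by blast
  have "\<bar>(if b then s else 1 - s) - (if b then s' else 1 - s')\<bar> = \<bar>s - s'\<bar>" by auto
  moreover have "(if b then s else 1 - s) \<in> {0..1}" "(if b then s' else 1 - s') \<in> {0..1}"
    using route_move(2,3) by auto
  ultimately show ?case
    using route.route_move[OF arc_image[OF route_move(1)], of "if b then s else 1 - s"
        "if b then s' else 1 - s'" k' "f y" r] route_move b k by auto
qed

lemma isometry:
  assumes k: "\<And>e. e \<in> arcs G \<Longrightarrow> k' (\<phi> e) = k e"
  shows "realization_isometry G k G' k' f"
proof -
  interpret inv: combinatorial_iso G' G "inv_into (realization G) f" "inv_into (arcs G) \<phi>"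
    by (rule inverse)
  have k': "k (inv_into (arcs G) \<phi> e') = k' e'" if "e' \<in> arcs G'" for e'
    using k[OF inv.arc_image[OF that]] bij_betw_inv_into_right[OF bij_arcs that] by simp
  have "route G' k' (f x) (f y) r \<longleftrightarrow> route G k x y r"
    if "x \<in> realization G" "y \<in> realization G" for x y r
    using route_image[of k x y r k'] inv.route_image[of k' "f x" "f y" r k] k k'
      bij_betw_inv_into_left[OF bij_points] that by metis
  then show ?thesis using bij_points by (simp add: realization_isometry_def realization_dist_def)
qed

lemma undirected_cycle_image:
  assumes c: "undirected_cycle G c"
  shows "\<exists>c'. undirected_cycle G' c' \<and> fst ` set c' = \<phi> ` fst ` set c"
proof -
  obtain \<beta> where \<beta>: "\<And>e s. e \<in> arcs G \<Longrightarrow> s \<in> {0..1} \<Longrightarrow>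
      f (edge_point G e s) = edge_point G' (\<phi> e) (if \<beta> e then s else 1 - s)"
    using maps_edge unfolding maps_edge_def by metis
  define \<psi> where "\<psi> = (\<lambda>(e, b). (\<phi> e, b = \<beta> e))"
  have ends: "Vertex (step_source G' (\<psi> s)) = f (Vertex (step_source G s))"
      "Vertex (step_target G' (\<psi> s)) = f (Vertex (step_target G s))" if "fst s \<in> arcs G" for s
    using \<beta>[OF that, of 0] \<beta>[OF that, of 1]
    by (cases s; auto simp: \<psi>_def step_source_def step_target_def)+
  have arcs: "fst ` set c \<subseteq> arcs G" using c by (simp add: undirected_cycle_def)
  have src_in: "Vertex (step_source G s) \<in> realization G" if "s \<in> set c" for s
    using that arcs by (auto simp: step_source_def)
  have fst\<psi>: "fst (\<psi> s) = \<phi> (fst s)" for s by (cases s) (simp add: \<psi>_def)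
  have "undirected_cycle G' (map \<psi> c)"
    unfolding undirected_cycle_def
  proof (intro conjI allI impI)
    show "map \<psi> c \<noteq> []" using c by (simp add: undirected_cycle_def)
    show "fst ` set (map \<psi> c) \<subseteq> arcs G'" using arcs arc_image by (auto simp: fst\<psi>)
    have "inj_on \<phi> (set (map fst c))"
      using bij_betw_imp_inj_on[OF bij_arcs] arcs by (auto intro: inj_on_subset)
    then have "distinct (map \<phi> (map fst c))"
      using c by (simp add: undirected_cycle_def distinct_map del: map_map)
    moreover have "map \<phi> (map fst c) = map fst (map \<psi> c)" by (simp add: fst\<psi>)
    ultimately show "distinct (map fst (map \<psi> c))" by metis
    show "distinct (map (step_source G') (map \<psi> c))"
    proof -
      have "inj_on (step_source G' \<circ> \<psi>) (set c)"
      proof (rule inj_onI)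
        fix s s' assume s: "s \<in> set c" "s' \<in> set c" "(step_source G' \<circ> \<psi>) s = (step_source G' \<circ> \<psi>) s'"
        then have "fst s \<in> arcs G" "fst s' \<in> arcs G" using arcs by auto
        then have "f (Vertex (step_source G s)) = f (Vertex (step_source G s'))"
          using s(3) ends(1)[of s] ends(1)[of s'] by simp
        from inj_onD[OF bij_betw_imp_inj_on[OF bij_points] this src_in[OF s(1)] src_in[OF s(2)]]
        have "step_source G s = step_source G s'" by simp
        then show "s = s'"
          using c s by (auto simp: undirected_cycle_def distinct_map dest: inj_onD)
      qed
      then show ?thesis using c by (simp add: undirected_cycle_def distinct_map)
    qed
    fix i assume i: "i < length (map \<psi> c)"
    let ?j = "Suc i mod length c"
    have len: "i < length c" using i by simp
    moreover have "?j < length c" using c by (simp add: undirected_cycle_def)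
    ultimately have len: "i < length c" "?j < length c" by simp_all
    then have "fst (c ! i) \<in> arcs G" "fst (c ! ?j) \<in> arcs G" using arcs by auto
    moreover have "step_target G (c ! i) = step_source G (c ! ?j)"
      using c len by (simp add: undirected_cycle_def)
    ultimately have "step_target G' (\<psi> (c ! i)) = step_source G' (\<psi> (c ! ?j))"
      using ends by (metis point.inject(1))
    then show "step_target G' (map \<psi> c ! i) = step_source G' (map \<psi> c ! (Suc i mod length (map \<psi> c)))"
      using len by simp
  qed
  moreover have "fst ` set (map \<psi> c) = \<phi> ` fst ` set c" by (auto simp: fst\<psi> image_image)
  ultimately show ?thesis by blast
qed

lemma induces_forest_image_imp:
  assumes "induces_forest G' (\<phi> ` F)"
  shows "induces_forest G F"
  unfolding induces_forest_def
proof
  assume "\<exists>c. undirected_cycle G c \<and> fst ` set c \<subseteq> F"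
  then obtain c where c: "undirected_cycle G c" "fst ` set c \<subseteq> F" by blast
  from undirected_cycle_image[OF c(1)] obtain c' where
    "undirected_cycle G' c'" "fst ` set c' = \<phi> ` fst ` set c" by blast
  moreover have "\<phi> ` fst ` set c \<subseteq> \<phi> ` F" using c(2) by (rule image_mono)
  ultimately show False using assms unfolding induces_forest_def by metis
qed

lemma induces_forest_image_iff:
  assumes F: "F \<subseteq> arcs G"
  shows "induces_forest G' (\<phi> ` F) \<longleftrightarrow> induces_forest G F"
proof
  interpret inv: combinatorial_iso G' G "inv_into (realization G) f" "inv_into (arcs G) \<phi>"
    by (rule inverse)
  have "inv_into (arcs G) \<phi> ` \<phi> ` F = F"
    using bij_betw_imp_inj_on[OF bij_arcs] F by (rule inv_into_image_cancel)
  then show "induces_forest G F \<Longrightarrow> induces_forest G' (\<phi> ` F)"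
    using inv.induces_forest_image_imp[of "\<phi> ` F"] by simp
qed (rule induces_forest_image_imp)

context
  fixes l :: "'e \<Rightarrow> real" and l' :: "'f \<Rightarrow> real"
  assumes cyc: "\<not> induces_forest G (arcs G)" and l': "\<And>e. e \<in> arcs G \<Longrightarrow> l' (\<phi> e) = l e"
begin

lemma arcs_image: "\<phi> ` arcs G = arcs G'"
  using bij_arcs by (simp add: bij_betw_def)

lemma lengths_image: "l' ` arcs G' = l ` arcs G"
  unfolding arcs_image[symmetric] image_image using l' by (rule image_cong[OF refl])

lemma cycle_threshold_image: "cycle_threshold G' l' = cycle_threshold G l"
proof (rule cycle_threshold_unique)
  let ?r = "cycle_threshold G l"
  have "{e \<in> arcs G'. l' e \<le> ?r} = \<phi> ` {e \<in> arcs G. l e \<le> ?r}"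
    "{e \<in> arcs G'. l' e < ?r} = \<phi> ` {e \<in> arcs G. l e < ?r}"
    unfolding arcs_image[symmetric] using l' by auto
  then show "\<not> induces_forest G' {e \<in> arcs G'. l' e \<le> ?r}" "induces_forest G' {e \<in> arcs G'. l' e < ?r}"
    using cycle_threshold_props(1,2)[OF A.finite_arcs cyc, of l] induces_forest_image_iff
    by simp_all
qed (rule B.finite_arcs)

lemma interpolated_length_image:
  assumes "e \<in> arcs G"
  shows "interpolated_length G' l' t (\<phi> e) = interpolated_length G l t e"
  using assms arc_image l'
  by (simp add: interpolated_length_def lengths_image cycle_threshold_image)

lemma filtered_by_forests_image: "filtered_by_forests G' l' \<longleftrightarrow> filtered_by_forests G l"
proof -
  have "\<not> induces_forest G' (arcs G')"
    using cyc induces_forest_image_iff[of "arcs G"] arcs_image by simp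
  then show ?thesis
    using filtered_by_forests_iff[OF A.finite_arcs cyc, of l]
      filtered_by_forests_iff[OF B.finite_arcs, of l'] by (simp add: lengths_image cycle_threshold_image)
qed

end

end

text \<open>
  The midpoint of an edge tells which edge it is, so that \<open>\<phi>\<close> inherits injectivity and surjectivity
  from \<open>f\<close>.
\<close>

lemma (in branched_isometry) combinatorial:
  obtains \<phi> where "combinatorial_iso G G' f \<phi>" "\<And>e. e \<in> arcs G \<Longrightarrow> l' (\<phi> e) = l e"
proof -
  obtain \<phi> where \<phi>: "\<And>e. e \<in> arcs G \<Longrightarrow> \<phi> e \<in> arcs G' \<and> l' (\<phi> e) = l e \<and> maps_edge G G' f e (\<phi> e)"
    using maps_edge_exists by metis
  have mid: "\<exists>u. f (Interior e (1 / 2)) = Interior e' u" if "maps_edge G G' f e e'" for e e'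
    using that unfolding maps_edge_def edge_point_def
    by (auto dest!: bspec[of _ _ "1 / 2"] split: if_splits)
  have "bij_betw \<phi> (arcs G) (arcs G')"
    unfolding bij_betw_def
  proof
    show "inj_on \<phi> (arcs G)"
    proof (rule inj_onI)
      fix e1 e2 assume e: "e1 \<in> arcs G" "e2 \<in> arcs G" "\<phi> e1 = \<phi> e2"
      from \<phi>[OF e(1)] obtain b1 where b1: "\<And>s. s \<in> {0..1} \<Longrightarrow>
        f (edge_point G e1 s) = edge_point G' (\<phi> e1) (if b1 then s else 1 - s)"
        unfolding maps_edge_def by blast
      from \<phi>[OF e(2)] obtain b2 where b2: "\<And>s. s \<in> {0..1} \<Longrightarrow>
        f (edge_point G e2 s) = edge_point G' (\<phi> e2) (if b2 then s else 1 - s)"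
        unfolding maps_edge_def by blast
      have "f (edge_point G e1 (1 / 2)) = f (edge_point G e2 (1 / 2))"
        using b1[of "1 / 2"] b2[of "1 / 2"] e(3) by (cases b1; cases b2) auto
      then have "f (Interior e1 (1 / 2)) = f (Interior e2 (1 / 2))" by (simp add: edge_point_def)
      then have "Interior e1 (1 / 2) = (Interior e2 (1 / 2) :: ('v, 'e) point)"
        using bij_betw_imp_inj_on[OF bij] e by (auto dest: inj_onD)
      then show "e1 = e2" by simp
    qed
    show "\<phi> ` arcs G = arcs G'"
    proof
      show "\<phi> ` arcs G \<subseteq> arcs G'" using \<phi> by auto
      show "arcs G' \<subseteq> \<phi> ` arcs G"
      proof
        fix e' assume e': "e' \<in> arcs G'"
        interpret inv: branched_isometry G' l' G l "inv_into (realization G) f" by (rule inverse)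
        obtain e where e: "e \<in> arcs G" "maps_edge G' G (inv_into (realization G) f) e' e"
          using inv.maps_edge_exists[OF e'] by blast
        then obtain b where b: "\<And>s. s \<in> {0..1} \<Longrightarrow>
            inv_into (realization G) f (edge_point G' e' s) = edge_point G e (if b then s else 1 - s)"
          unfolding maps_edge_def by blast
        have "inv_into (realization G) f (Interior e' (1 / 2)) = Interior e (1 / 2)"
          using b[of "1 / 2"] by (simp add: edge_point_def)
        then have "f (Interior e (1 / 2)) = Interior e' (1 / 2)"
          using bij_betw_inv_into_right[OF bij, of "Interior e' (1 / 2)"] e' by simp
        moreover obtain u where "f (Interior e (1 / 2)) = Interior (\<phi> e) u"
          using mid \<phi>[OF e(1)] by blast
        ultimately show "e' \<in> \<phi> ` arcs G" using e(1) by auto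
      qed
    qed
  qed
  then have "combinatorial_iso G G' f \<phi>"
    using \<phi> bij by unfold_locales (auto simp: A.fin_digraph B.fin_digraph)
  then show thesis using that \<phi> by blast
qed

lemma metric_graph_stable:
  assumes "stable G" "\<And>e. e \<in> arcs G \<Longrightarrow> 0 < l e"
  shows "metric_graph G l"
  using assms by (auto simp: metric_graph_def stable_def intro: connected_imp_joined)

lemma loop_graph_filtered:
  assumes "arcs G = {e}" "\<not> induces_forest G (arcs G)"
  shows "filtered_by_forests G l"
  using assms cycle_threshold_props(3)[of G l] by (simp add: filtered_by_forests_iff)

lemma loop_graph_point_valency:
  assumes "arcs G = {e}"
  shows "point_valency G x \<le> 2"
proof (cases x)
  case (Vertex v)
  have "half_edges G v \<subseteq> {e} \<times> UNIV"
    unfolding half_edges_def assms by (simp add: subset_iff mem_Times_iff)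
  from card_mono[OF _ this] have "valency G v \<le> 2"
    using card_half_edges[of G v] assms by (simp add: card_cartesian_product)
  then show ?thesis using Vertex by simp
qed simp

text \<open>
  On a single loop, where the vertex is not determined by the metric, the deformation does nothing;
  in all other stable graphs of positive genus the vertices have valency at least 3.
\<close>

lemma isometry_interpolated_length:
  assumes G: "stable G" "genus G \<ge> 1" "l \<in> extensional (arcs G)" "\<And>e. e \<in> arcs G \<Longrightarrow> 0 < l e"
    and G': "stable G'" "genus G' \<ge> 1" "l' \<in> extensional (arcs G')" "\<And>e. e \<in> arcs G' \<Longrightarrow> 0 < l' e"
    and iso: "realization_isometry G l G' l' f"
  shows "realization_isometry G (interpolated_length G l t) G' (interpolated_length G' l' t) f"
    and "filtered_by_forests G' l' \<longleftrightarrow> filtered_by_forests G l"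
proof -
  interpret A: metric_graph G l using metric_graph_stable G by blast
  interpret B: metric_graph G' l' using metric_graph_stable G' by blast
  have ne: "arcs G \<noteq> {}" "arcs G' \<noteq> {}" using genus_pos_arcs_nonempty G(1,2) G'(1,2) by metis+
  have cyc: "\<not> induces_forest G (arcs G)" "\<not> induces_forest G' (arcs G')"
    using stable_not_forest G(1) G'(1) ne by metis+
  have val: "point_valency G' (f x) = point_valency G x" if "x \<in> realization G" for x
    using point_valency_isometry[OF A.metric_graph_axioms B.metric_graph_axioms iso that] .
  have bij: "bij_betw f (realization G) (realization G')"
    using iso by (simp add: realization_isometry_def)
  have "realization_isometry G (interpolated_length G l t) G' (interpolated_length G' l' t) f \<and>
    (filtered_by_forests G' l' \<longleftrightarrow> filtered_by_forests G l)"
  proof (cases "\<exists>e. arcs G = {e}")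
    case True
    then have valG: "point_valency G x \<le> 2" for x using loop_graph_point_valency by metis
    have "\<exists>e. arcs G' = {e}"
    proof (rule stable_cases[OF G'(1,2)])
      assume branch: "\<forall>v \<in> verts G'. 3 \<le> valency G' v"
      from ne obtain e where "e \<in> arcs G'" by blast
      then have v: "tail G' e \<in> verts G'" by simp
      then obtain x where x: "x \<in> realization G" "f x = Vertex (tail G' e)"
        using bij by (auto simp: bij_betw_def image_iff)
          (metis imageE vertex_in_realization)
      then have "valency G' (tail G' e) \<le> 2" using val[OF x(1)] valG[of x] by simp
      moreover have "3 \<le> valency G' (tail G' e)" using branch v by blast
      ultimately show ?thesis by linarith
    qed blast
    then have "filtered_by_forests G l" "filtered_by_forests G' l'"
      using True loop_graph_filtered cyc by metis+
    then show ?thesis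
      using interpolated_length_filtered[OF A.finite_arcs cyc(1) G(4,3)]
        interpolated_length_filtered[OF B.finite_arcs cyc(2) G'(4,3)] iso by simp
  next
    case False
    then have branch: "\<forall>v \<in> verts G. 3 \<le> valency G v" using stable_cases[OF G(1,2)] by metis
    have branch': "\<forall>v \<in> verts G'. 3 \<le> valency G' v"
    proof (rule stable_cases[OF G'(1,2)])
      fix e' assume loop: "arcs G' = {e'}"
      from ne obtain e where "e \<in> arcs G" by blast
      then have v: "tail G e \<in> verts G" by simp
      then have "valency G (tail G e) \<le> 2"
        using val[of "Vertex (tail G e)"] loop_graph_point_valency[OF loop, of "f (Vertex (tail G e))"]
        by simp
      moreover have "3 \<le> valency G (tail G e)" using branch v by blast
      ultimately show ?thesis by linarith
    qed
    interpret branched_isometry G l G' l' f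
      using branch branch' iso by unfold_locales auto
    obtain \<phi> where \<phi>: "combinatorial_iso G G' f \<phi>" "\<And>e. e \<in> arcs G \<Longrightarrow> l' (\<phi> e) = l e"
      using combinatorial by blast
    interpret combinatorial_iso G G' f \<phi> by fact
    show ?thesis
      using isometry[of "interpolated_length G' l' t" "interpolated_length G l t"]
        interpolated_length_image[where l = l and l' = l', OF cyc(1) \<phi>(2)]
        filtered_by_forests_image[where l = l and l' = l', OF cyc(1) \<phi>(2)] by blast
  qed
  then show "realization_isometry G (interpolated_length G l t) G' (interpolated_length G' l' t) f"
    "filtered_by_forests G' l' \<longleftrightarrow> filtered_by_forests G l" by blast+
qed


section \<open>The deformation on isometry classes\<close>

definition flow :: "real \<Rightarrow> marked_graph \<Rightarrow> marked_graph" where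
  "flow t = (\<lambda>(G, l, p). (G, flow_length G l t, p))"

lemma stable_graphs_props:
  assumes "1 \<le> g" "G \<in> stable_graphs g"
  shows "stable G" "genus G \<ge> 1" "fin_digraph G" "finite (arcs G)" "\<not> induces_forest G (arcs G)"
proof -
  show G: "stable G" "genus G \<ge> 1" using assms by (auto simp: stable_graphs_def)
  then show "fin_digraph G" "finite (arcs G)" by (auto simp: stable_def fin_digraph.finite_arcs)
  show "\<not> induces_forest G (arcs G)"
    using stable_not_forest[OF G(1) genus_pos_arcs_nonempty[OF G]] .
qed

lemma interpolated_length_eq_0_iff:
  assumes "e \<in> arcs G" "0 \<le> l e" "0 < cycle_threshold G l" "0 < Max (l ` arcs G)" "t \<in> {0..1}"
  shows "0 \<le> interpolated_length G l t e" "interpolated_length G l t e = 0 \<longleftrightarrow> l e = 0"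
proof -
  let ?a = "(1 - t) * l e" and ?b = "t * (Max (l ` arcs G) * min 1 (l e / cycle_threshold G l))"
  have eq: "interpolated_length G l t e = ?a + ?b" using assms(1) by (simp add: interpolated_length_def)
  have ab: "0 \<le> ?a" "0 \<le> ?b" using assms by (simp_all add: less_imp_le)
  then show "0 \<le> interpolated_length G l t e" using eq by simp
  have "?a + ?b = 0 \<longleftrightarrow> ?a = 0 \<and> ?b = 0" using ab by (rule add_nonneg_eq_0_iff)
  also have "\<dots> \<longleftrightarrow> l e = 0" using assms by (auto simp: min_def)
  finally show "interpolated_length G l t e = 0 \<longleftrightarrow> l e = 0" using eq by simp
qed

lemma interpolated_length_pos:
  assumes "finite (arcs G)" "\<not> induces_forest G (arcs G)" and pos: "\<And>e. e \<in> arcs G \<Longrightarrow> 0 < l e"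
    and "e \<in> arcs G" "t \<in> {0..1}"
  shows "0 < interpolated_length G l t e"
proof -
  have "Max (l ` arcs G) \<in> l ` arcs G" using assms by (intro Max_in) auto
  then have "0 < Max (l ` arcs G)" using pos by auto
  then show ?thesis
    using interpolated_length_eq_0_iff[of e G l t] cycle_threshold_pos[of G l] assms
    by (smt (verit))
qed

lemma equiv_marked_isometric: "equiv (marked_graphs g n) (marked_isometric g n)"
proof (rule equivI)
  show "marked_isometric g n \<subseteq> marked_graphs g n \<times> marked_graphs g n"
    by (auto simp: marked_isometric_def)
  have "realization_isometry G l G l id" for G :: graph and l
    by (simp add: realization_isometry_def)
  then show "refl_on (marked_graphs g n) (marked_isometric g n)"
    by (auto simp: refl_on_def marked_isometric_def intro!: exI[of _ id])
  show "sym (marked_isometric g n)"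
  proof (rule symI)
    fix X X' assume "(X, X') \<in> marked_isometric g n"
    then obtain G l p G' l' p' f where X: "X = (G, l, p)" "X' = (G', l', p')"
      "(G, l, p) \<in> marked_graphs g n" "(G', l', p') \<in> marked_graphs g n"
      and f: "realization_isometry G l G' l' f" "\<And>j. j \<in> {1..n} \<Longrightarrow> f (p j) = p' j"
      by (auto simp: marked_isometric_def)
    have inj: "inj_on f (realization G)"
      using f(1) by (simp add: realization_isometry_def bij_betw_def)
    have "inv_into (realization G) f (p' j) = p j" if j: "j \<in> {1..n}" for j
    proof -
      have "p j \<in> realization G" using X(3) j by (auto simp: marked_graphs_def)
      then show ?thesis using inv_into_f_f[OF inj] f(2)[OF j] by metis
    qed
    then show "(X', X) \<in> marked_isometric g n"
      using X realization_isometry_inv[OF f(1)] by (auto simp: marked_isometric_def)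
  qed
  show "trans (marked_isometric g n)"
  proof (rule transI)
    fix X Y Z assume "(X, Y) \<in> marked_isometric g n" "(Y, Z) \<in> marked_isometric g n"
    then obtain G l p G' l' p' G'' l'' p'' f h where
      X: "X = (G, l, p)" "Y = (G', l', p')" "Z = (G'', l'', p'')"
      "X \<in> marked_graphs g n" "Z \<in> marked_graphs g n"
      and f: "realization_isometry G l G' l' f" "\<And>j. j \<in> {1..n} \<Longrightarrow> f (p j) = p' j"
      and h: "realization_isometry G' l' G'' l'' h" "\<And>j. j \<in> {1..n} \<Longrightarrow> h (p' j) = p'' j"
      unfolding marked_isometric_def by fastforce
    have "realization_isometry G l G'' l'' (h \<circ> f)"
      using f(1) h(1) bij_betw_apply[of f "realization G" "realization G'"]
      by (auto simp: realization_isometry_def intro: bij_betw_trans)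
    moreover have "(h \<circ> f) (p j) = p'' j" if "j \<in> {1..n}" for j using f(2) h(2) that by simp
    ultimately show "(X, Z) \<in> marked_isometric g n"
      using X unfolding marked_isometric_def by blast
  qed
qed

lemma flow_in_marked_graphs:
  assumes g: "1 \<le> g" and t: "t \<in> {0..1}" and X: "X \<in> marked_graphs g n"
  shows "flow t X \<in> marked_graphs g n"
proof -
  obtain G l p where X_eq: "X = (G, l, p)" by (cases X)
  have G: "G \<in> stable_graphs g" and pos: "\<And>e. e \<in> arcs G \<Longrightarrow> 0 < l e"
    using X X_eq by (auto simp: marked_graphs_def PiE_iff)
  note Gp = stable_graphs_props[OF g G]
  have "flow_length G l t = interpolated_length G l t"
    by (rule flow_length_eq_interpolated_length[OF Gp(4,5)]) (rule pos)
  moreover have "0 < interpolated_length G l t e" if "e \<in> arcs G" for e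
    using pos that t by (rule interpolated_length_pos[OF Gp(4,5)])
  ultimately have "flow_length G l t \<in> PiE (arcs G) (\<lambda>_. {0<..})"
    by (simp add: PiE_iff) (simp add: interpolated_length_def)
  then show ?thesis using X X_eq by (auto simp: marked_graphs_def flow_def)
qed

lemma marked_isometric_flow:
  assumes g: "1 \<le> g" and t: "t \<in> {0..1}" and X: "(X, X') \<in> marked_isometric g n"
  shows "(flow t X, flow t X') \<in> marked_isometric g n"
    and "filtered_by_forests (fst X') (fst (snd X')) \<longleftrightarrow> filtered_by_forests (fst X) (fst (snd X))"
proof -
  obtain G l p G' l' p' f where eq: "X = (G, l, p)" "X' = (G', l', p')"
    and in': "X \<in> marked_graphs g n" "X' \<in> marked_graphs g n"
    and f: "realization_isometry G l G' l' f" "\<And>j. j \<in> {1..n} \<Longrightarrow> f (p j) = p' j"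
    using X by (auto simp: marked_isometric_def)
  have G: "G \<in> stable_graphs g" "l \<in> extensional (arcs G)" "\<And>e. e \<in> arcs G \<Longrightarrow> 0 < l e"
    and G': "G' \<in> stable_graphs g" "l' \<in> extensional (arcs G')" "\<And>e. e \<in> arcs G' \<Longrightarrow> 0 < l' e"
    using in' eq by (auto simp: marked_graphs_def PiE_iff)
  note Gp = stable_graphs_props[OF g G(1)] and Gp' = stable_graphs_props[OF g G'(1)]
  note iso = isometry_interpolated_length[OF Gp(1,2) G(2,3) Gp'(1,2) G'(2,3) f(1)]
  have "realization_isometry G (flow_length G l t) G' (flow_length G' l' t) f"
    using iso(1)[of t] flow_length_eq_interpolated_length[OF Gp(4,5) G(3)]
      flow_length_eq_interpolated_length[OF Gp'(4,5) G'(3)] by simp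
  then show "(flow t X, flow t X') \<in> marked_isometric g n"
    using flow_in_marked_graphs[OF g t in'(1)] flow_in_marked_graphs[OF g t in'(2)] f(2) eq
    unfolding marked_isometric_def flow_def by auto
  show "filtered_by_forests (fst X') (fst (snd X')) \<longleftrightarrow> filtered_by_forests (fst X) (fst (snd X))"
    using iso(2) eq by simp
qed

text \<open>
  Isometric representatives have isometric images, so the union that defines \<open>Phi\<close> is a single class.
\<close>

lemma Phi_class:
  assumes g: "1 \<le> g" and t: "t \<in> {0..1}" and X: "X \<in> marked_graphs g n"
  shows "Phi g n (marked_isometric g n `` {X}) t = marked_isometric g n `` {flow t X}"
proof -
  note eqv = equiv_marked_isometric[of g n]
  have "Phi g n (marked_isometric g n `` {X}) t =
      (\<Union>Y \<in> marked_isometric g n `` {X}. marked_isometric g n `` {flow t Y})"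
    by (auto simp: Phi_def flow_def split: prod.splits)
  also have "\<dots> = (\<Union>Y \<in> marked_isometric g n `` {X}. marked_isometric g n `` {flow t X})"
  proof (rule SUP_cong[OF refl])
    fix Y assume "Y \<in> marked_isometric g n `` {X}"
    then have "(X, Y) \<in> marked_isometric g n" by simp
    from equiv_class_eq[OF eqv marked_isometric_flow(1)[OF g t this]]
    show "marked_isometric g n `` {flow t Y} = marked_isometric g n `` {flow t X}" by simp
  qed
  also have "\<dots> = marked_isometric g n `` {flow t X}"
    using equiv_class_self[OF eqv X] by blast
  finally show ?thesis .
qed


section \<open>Continuity on the charts\<close>

lemma continuous_map_Max:
  fixes f :: "'i \<Rightarrow> 'a \<Rightarrow> real"
  assumes "finite I" "I \<noteq> {}" "\<And>i. i \<in> I \<Longrightarrow> continuous_map X euclideanreal (f i)"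
  shows "continuous_map X euclideanreal (\<lambda>x. Max ((\<lambda>i. f i x) ` I))"
  using assms
proof (induction I rule: finite_ne_induct)
  case (insert i I)
  then have "(\<lambda>x. Max ((\<lambda>i. f i x) ` insert i I)) = (\<lambda>x. max (f i x) (Max ((\<lambda>i. f i x) ` I)))"
    by simp
  moreover have "continuous_map X euclideanreal (\<lambda>x. max (f i x) (Max ((\<lambda>i. f i x) ` I)))"
    using insert by (intro continuous_map_real_max) auto
  ultimately show ?case by (simp only:)
qed simp

lemma continuous_map_Min:
  fixes f :: "'i \<Rightarrow> 'a \<Rightarrow> real"
  assumes "finite I" "I \<noteq> {}" "\<And>i. i \<in> I \<Longrightarrow> continuous_map X euclideanreal (f i)"
  shows "continuous_map X euclideanreal (\<lambda>x. Min ((\<lambda>i. f i x) ` I))"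
  using assms
proof (induction I rule: finite_ne_induct)
  case (insert i I)
  then have "(\<lambda>x. Min ((\<lambda>i. f i x) ` insert i I)) = (\<lambda>x. min (f i x) (Min ((\<lambda>i. f i x) ` I)))"
    by simp
  moreover have "continuous_map X euclideanreal (\<lambda>x. min (f i x) (Min ((\<lambda>i. f i x) ` I)))"
    using insert by (intro continuous_map_real_min) auto
  ultimately show ?case by (simp only:)
qed simp

lemma continuous_map_cycle_threshold:
  assumes fin: "finite (arcs G)" and cyc: "\<not> induces_forest G (arcs G)"
    and cont: "\<And>e. e \<in> arcs G \<Longrightarrow> continuous_map X euclideanreal (\<lambda>x. l x e)"
  shows "continuous_map X euclideanreal (\<lambda>x. cycle_threshold G (l x))"
  unfolding cycle_threshold_def
proof (rule continuous_map_Min)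
  fix F assume "F \<in> {F. F \<subseteq> arcs G \<and> \<not> induces_forest G F}"
  then have F: "F \<subseteq> arcs G" "\<not> induces_forest G F" by auto
  then have "F \<noteq> {}" by auto
  with F fin cont show "continuous_map X euclideanreal (\<lambda>x. Max (l x ` F))"
    by (intro continuous_map_Max) (auto intro: finite_subset)
qed (use fin cyc in auto)

text \<open>
  On a chart the edges of length 0 form a forest, so the threshold stays positive.
\<close>

lemma length_functions_props:
  assumes fin: "finite (arcs G)" and cyc: "\<not> induces_forest G (arcs G)"
    and l: "l \<in> length_functions G"
  shows "0 < cycle_threshold G l" "0 < Max (l ` arcs G)"
proof -
  note thr = cycle_threshold_props[OF fin cyc, of l]
  have nonneg: "0 \<le> l e" if "e \<in> arcs G" for e using l that by (auto simp: length_functions_def)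
  have "cycle_threshold G l \<noteq> 0"
  proof
    assume "cycle_threshold G l = 0"
    then have "{e \<in> arcs G. l e \<le> cycle_threshold G l} = zero_edges G l"
      using nonneg by (auto simp: zero_edges_def intro: antisym)
    then show False using thr(1) l by (auto simp: length_functions_def)
  qed
  moreover have "0 \<le> cycle_threshold G l" using thr(3) nonneg by auto
  ultimately show "0 < cycle_threshold G l" by simp
  moreover have "cycle_threshold G l \<le> Max (l ` arcs G)" using thr(3) fin by (intro Max_ge) auto
  ultimately show "0 < Max (l ` arcs G)" by linarith
qed

lemma interpolated_length_in_length_functions:
  assumes fin: "finite (arcs G)" and cyc: "\<not> induces_forest G (arcs G)"
    and l: "l \<in> length_functions G" and t: "t \<in> {0..1}"
  shows "interpolated_length G l t \<in> length_functions G"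
    and "zero_edges G (interpolated_length G l t) = zero_edges G l"
proof -
  have "0 \<le> l e" if "e \<in> arcs G" for e using l that by (auto simp: length_functions_def)
  then have *: "0 \<le> interpolated_length G l t e" "interpolated_length G l t e = 0 \<longleftrightarrow> l e = 0"
    if "e \<in> arcs G" for e
    using interpolated_length_eq_0_iff[OF that] length_functions_props[OF assms(1-3)] t that by auto
  then show zero: "zero_edges G (interpolated_length G l t) = zero_edges G l"
    by (auto simp: zero_edges_def)
  have "interpolated_length G l t \<in> PiE (arcs G) (\<lambda>_. {0..})"
    using *(1) by (auto simp: PiE_iff interpolated_length_def)
  then show "interpolated_length G l t \<in> length_functions G"
    using l zero by (simp add: length_functions_def)
qed

lemma topspace_chart_space:
  assumes "fin_digraph G"
  shows "topspace (chart_space n G) = length_functions G \<times> PiE {1..n} (\<lambda>_. realization G)"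
proof -
  have "wf_digraph G" using assms by (simp add: fin_digraph_def)
  moreover have "length_functions G \<subseteq> topspace (product_topology (\<lambda>_. euclideanreal) (arcs G))"
    by (auto simp: length_functions_def PiE_iff extensional_def)
  ultimately show ?thesis
    by (simp add: chart_space_def topspace_subtopology topspace_realization_topology
        Int_absorb1 del: topspace_product_topology)
      (simp add: topspace_realization_topology)
qed

lemma continuous_map_chart_deformation:
  assumes G: "fin_digraph G" and cyc: "\<not> induces_forest G (arcs G)"
  shows "continuous_map (prod_topology (chart_space n G) (top_of_set {0..1})) (chart_space n G)
    (\<lambda>(x, t). (interpolated_length G (fst x) t, snd x))" (is "continuous_map ?X _ _")
proof -
  note fin = fin_digraph.finite_arcs[OF G]
  let ?L = "subtopology (product_topology (\<lambda>_. euclideanreal) (arcs G)) (length_functions G)"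
    and ?P = "product_topology (\<lambda>_. realization_topology G) {1..n}"
  have X: "topspace ?X = (length_functions G \<times> PiE {1..n} (\<lambda>_. realization G)) \<times> {0..1}"
    by (simp add: topspace_chart_space[OF G])
  have chart: "continuous_map ?X (prod_topology ?L ?P) fst"
    unfolding chart_space_def by (rule continuous_map_fst)
  have lp: "continuous_map ?X ?L (\<lambda>x. fst (fst x))" "continuous_map ?X ?P (\<lambda>x. snd (fst x))"
    using chart by (simp_all add: continuous_map_pairwise o_def)
  have l: "continuous_map ?X euclideanreal (\<lambda>x. fst (fst x) e)" if "e \<in> arcs G" for e
    using lp(1) that by (simp add: continuous_map_in_subtopology continuous_map_componentwise)
  have t: "continuous_map ?X euclideanreal snd"
    using continuous_map_snd[of "chart_space n G" "top_of_set {0..1::real}"]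
    by (rule continuous_map_into_fulltopology)
  have thr: "cycle_threshold G (fst (fst x)) \<noteq> 0" if "x \<in> topspace ?X" for x
    using length_functions_props(1)[OF fin cyc, of "fst (fst x)"] that X by auto
  have "arcs G \<noteq> {}" using cyc by auto
  then have M: "continuous_map ?X euclideanreal (\<lambda>x. Max (fst (fst x) ` arcs G))"
    using l fin by (intro continuous_map_Max)
  have "continuous_map ?X euclideanreal (\<lambda>x. interpolated_length G (fst (fst x)) (snd x) e)"
    if e: "e \<in> arcs G" for e
    unfolding interpolated_length_def restrict_apply'[OF e]
    by (intro continuous_intros l[OF e] t thr M continuous_map_cycle_threshold[OF fin cyc] l) auto
  then have "continuous_map ?X ?L (\<lambda>x. interpolated_length G (fst (fst x)) (snd x))"
    using interpolated_length_in_length_functions(1)[OF fin cyc] X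
    by (auto simp: continuous_map_in_subtopology continuous_map_componentwise interpolated_length_def)
  then show ?thesis
    using lp(2) unfolding chart_space_def
    by (simp add: continuous_map_pairwise o_def case_prod_beta)
qed

text \<open>
  A product with a topological sum carries the topology of the sum of the products, since each summand
  is open.
\<close>

lemma continuous_map_sum_prod:
  assumes cont: "\<And>i. i \<in> I \<Longrightarrow>
      continuous_map (prod_topology (X i) T) (Y i) (\<lambda>(x, t). h i x t)"
  shows "continuous_map (prod_topology (sum_topology X I) T) (sum_topology Y I)
    (\<lambda>((i, x), t). (i, h i x t))"
  unfolding continuous_map_def
proof (intro conjI allI impI)
  have h: "h i x t \<in> topspace (Y i)" if "i \<in> I" "x \<in> topspace (X i)" "t \<in> topspace T" for i x t
    using continuous_map_image_subset_topspace[OF cont[OF that(1)]] that by fastforce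
  then show "(\<lambda>((i, x), t). (i, h i x t)) \<in>
      topspace (prod_topology (sum_topology X I) T) \<rightarrow> topspace (sum_topology Y I)"
    by auto
  fix U assume U: "openin (sum_topology Y I) U"
  let ?W = "{y \<in> topspace (prod_topology (sum_topology X I) T). (\<lambda>((i, x), t). (i, h i x t)) y \<in> U}"
  have "\<exists>A B. openin (sum_topology X I) A \<and> openin T B \<and> y \<in> A \<and> t \<in> B \<and> A \<times> B \<subseteq> ?W"
    if "(y, t) \<in> ?W" for y t
  proof -
    obtain i x where y: "y = (i, x)" by (cases y)
    have i: "i \<in> I" and x: "x \<in> topspace (X i)" and t: "t \<in> topspace T" and "(i, h i x t) \<in> U"
      using that y by auto
    let ?V = "{z \<in> topspace (prod_topology (X i) T). (\<lambda>(x, t). h i x t) z \<in> {y. (i, y) \<in> U}}"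
    have "openin (Y i) {y. (i, y) \<in> U}" using U i by (simp add: openin_sum_topology)
    then have "openin (prod_topology (X i) T) ?V"
      by (rule openin_continuous_map_preimage[OF cont[OF i]])
    moreover have "(x, t) \<in> ?V" using x t \<open>(i, h i x t) \<in> U\<close> by simp
    ultimately obtain A B where AB: "openin (X i) A" "openin T B" "x \<in> A" "t \<in> B" "A \<times> B \<subseteq> ?V"
      unfolding openin_prod_topology_alt by meson
    have "openin (sum_topology X I) (Pair i ` A)"
      using open_map_component_injection[OF i] AB(1) by (auto simp: open_map_def)
    moreover have "Pair i ` A \<times> B \<subseteq> ?W"
      using AB i openin_subset[OF AB(1)] openin_subset[OF AB(2)] by auto
    moreover have "y \<in> Pair i ` A" using AB(3) y by simp
    ultimately show ?thesis using AB(2,4) by blast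
  qed
  then show "openin (prod_topology (sum_topology X I) T) ?W"
    unfolding openin_prod_topology_alt by (intro allI impI)
qed


section \<open>Contraction commutes with the deformation\<close>

text \<open>
  The edges up to a given positive length contain the contracted forest, and contain a cycle before
  the contraction iff they do afterwards. So the threshold does not change, nor does the maximal
  length.
\<close>

lemma interpolated_length_contract_graph:
  assumes fin: "finite (arcs G)" and cyc: "\<not> induces_forest G (arcs G)"
    and l: "l \<in> length_functions G"
  defines "Z \<equiv> zero_edges G l"
  shows "flow_length (contract_graph G Z) (restrict l (arcs G - Z)) t =
    restrict (interpolated_length G l t) (arcs G - Z)"
proof -
  let ?H = "contract_graph G Z" and ?l = "restrict l (arcs G - Z)" and ?r = "cycle_threshold G l"
  let ?M = "Max (l ` arcs G)"
  note pos = length_functions_props[OF fin cyc l]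
  have Z: "Z \<subseteq> arcs G" "induces_forest G Z" using l by (auto simp: Z_def zero_edges_def length_functions_def)
  have lpos: "0 < ?l e" if "e \<in> arcs G - Z" for e
  proof -
    have "0 \<le> l e" "l e \<noteq> 0" using l that by (auto simp: length_functions_def Z_def zero_edges_def)
    then show ?thesis using that by simp
  qed
  have forest: "induces_forest ?H (F - Z) \<longleftrightarrow> induces_forest G F" if "Z \<subseteq> F" "F \<subseteq> arcs G" for F
    using induces_forest_contract_graph[OF that Z(2)] .
  have cycH: "\<not> induces_forest ?H (arcs ?H)" using forest[of "arcs G"] Z cyc by simp
  have finH: "finite (arcs ?H)" using fin by simp
  have thr: "cycle_threshold ?H ?l = ?r"
  proof (rule cycle_threshold_unique[OF finH])
    have "{e \<in> arcs ?H. ?l e \<le> ?r} = {e \<in> arcs G. l e \<le> ?r} - Z"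
      "{e \<in> arcs ?H. ?l e < ?r} = {e \<in> arcs G. l e < ?r} - Z" by auto
    moreover have "Z \<subseteq> {e \<in> arcs G. l e \<le> ?r}" "Z \<subseteq> {e \<in> arcs G. l e < ?r}"
      using pos(1) by (auto simp: Z_def zero_edges_def)
    ultimately show "\<not> induces_forest ?H {e \<in> arcs ?H. ?l e \<le> ?r}" "induces_forest ?H {e \<in> arcs ?H. ?l e < ?r}"
      using forest[of "{e \<in> arcs G. l e \<le> ?r}"] forest[of "{e \<in> arcs G. l e < ?r}"]
        cycle_threshold_props(1,2)[OF fin cyc, of l] by auto
  qed
  have max: "Max (?l ` arcs ?H) = ?M"
  proof (rule Max_eqI)
    have "arcs G \<noteq> {}" using cyc by auto
    then have "?M \<in> l ` arcs G" using fin by (intro Max_in) auto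
    then obtain e where e: "e \<in> arcs G" "l e = ?M" by auto
    then have "e \<in> arcs G - Z" using pos(2) by (auto simp: Z_def zero_edges_def)
    then show "?M \<in> ?l ` arcs ?H" using e(2) by (intro image_eqI[of _ _ e]) auto
  qed (use fin in auto)
  have "flow_length ?H ?l t = interpolated_length ?H ?l t"
    using finH cycH lpos by (intro flow_length_eq_interpolated_length) auto
  also have "\<dots> = restrict (interpolated_length G l t) (arcs G - Z)"
    unfolding interpolated_length_def thr max by (auto simp: restrict_def)
  finally show ?thesis .
qed

text \<open>
  The deformation changes the lengths only, and keeps them positive on the contracted graph. So either
  both contracted graphs represent points of the moduli space, or both classes are empty.
\<close>

lemma Phi_contract_zero_edges:
  assumes g: "1 \<le> g" and t: "t \<in> {0..1}" and G: "G \<in> stable_graphs g" and l: "l \<in> length_functions G"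
  shows "Phi g n (marked_isometric g n `` {contract_zero_edges n (G, l, p)}) t =
    marked_isometric g n `` {contract_zero_edges n (G, interpolated_length G l t, p)}"
proof -
  note Gp = stable_graphs_props[OF g G]
  let ?Y = "contract_zero_edges n (G, l, p)" and ?Z = "zero_edges G l"
  have Y: "contract_zero_edges n (G, interpolated_length G l t, p) = flow t ?Y"
    using interpolated_length_in_length_functions(2)[OF Gp(4,5) l t]
      interpolated_length_contract_graph[OF Gp(4,5) l, of t]
    by (simp add: contract_zero_edges_def flow_def)
  show ?thesis
  proof (cases "?Y \<in> marked_graphs g n")
    case True
    show ?thesis unfolding Y by (rule Phi_class[OF g t True])
  next
    case False
    have "restrict l (arcs G - ?Z) \<in> PiE (arcs G - ?Z) (\<lambda>_. {0<..})"
      using l by (force simp: length_functions_def zero_edges_def PiE_iff less_le)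
    then have "flow t ?Y \<notin> marked_graphs g n"
      using False by (auto simp: contract_zero_edges_def flow_def marked_graphs_def)
    then have "marked_isometric g n `` {flow t ?Y} = {}" "marked_isometric g n `` {?Y} = {}"
      using False by (auto simp: marked_isometric_def)
    then show ?thesis unfolding Y by (simp add: Phi_def)
  qed
qed

text \<open>
  The charts map onto the moduli space by a quotient map. Since the unit interval is locally compact
  and Hausdorff, its product with the quotient map is again a quotient map, so that continuity may be
  checked on the charts.
\<close>

lemma continuous_map_Phi:
  assumes g: "1 \<le> g"
  shows "continuous_map (prod_topology (TMb_topology g n) (top_of_set {0..1})) (TMb_topology g n)
    (\<lambda>(x, t). Phi g n x t)"
proof -
  let ?X = "sum_topology (chart_space n) (stable_graphs g)" and ?I = "top_of_set {0..1::real}"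
  let ?q = "\<lambda>x. marked_isometric g n `` {contract_zero_edges n x}"
  let ?d = "\<lambda>((G, x), t). (G, interpolated_length G (fst x) t, snd x)"
  have q: "quotient_map ?X (TMb_topology g n) ?q"
    unfolding TMb_topology_def by (rule quotient_map_quotient_topology)
  have I: "locally_compact_space ?I" "Hausdorff_space ?I"
    by (simp_all add: compact_imp_locally_compact_space compact_space_subtopology
        Hausdorff_space_subtopology)
  have "continuous_map (prod_topology ?X ?I) ?X ?d"
    using continuous_map_sum_prod[of "stable_graphs g" "chart_space n" ?I "chart_space n"
        "\<lambda>G x t. (interpolated_length G (fst x) t, snd x)"]
      continuous_map_chart_deformation stable_graphs_props(3,5)[OF g] by simp
  then have "continuous_map (prod_topology ?X ?I) (TMb_topology g n) (?q \<circ> ?d)"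
    using quotient_imp_continuous_map[OF q] by (rule continuous_map_compose)
  moreover have "(?q \<circ> ?d) y = ((\<lambda>(x, t). Phi g n x t) \<circ> (\<lambda>(x, t). (?q x, t))) y"
    if "y \<in> topspace (prod_topology ?X ?I)" for y
  proof -
    obtain G l p t where y: "y = ((G, (l, p)), t)" by (metis prod.exhaust)
    have "G \<in> stable_graphs g" "t \<in> {0..1}" using that y by auto
    moreover have "l \<in> length_functions G"
      using that y topspace_chart_space stable_graphs_props(3)[OF g] by auto
    ultimately show ?thesis using Phi_contract_zero_edges[OF g] y by simp
  qed
  ultimately have "continuous_map (prod_topology ?X ?I) (TMb_topology g n)
      ((\<lambda>(x, t). Phi g n x t) \<circ> (\<lambda>(x, t). (?q x, t)))"
    by (rule continuous_map_eq)
  then show ?thesis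
    using continuous_compose_quotient_map[OF quotient_map_prod_left[OF I(1) _ q]] I(2) by blast
qed


section \<open>The strong deformation retraction\<close>

theorem theorem2p6:
  fixes g n :: nat
  assumes "g \<ge> 1"
  shows "continuous_map (prod_topology (TMb_topology g n) (top_of_set {0..1})) (TMb_topology g n)
           (\<lambda>(x, t). Phi g n x t) \<and>
         (\<forall>x \<in> TMb g n. Phi g n x 0 = x \<and> Phi g n x 1 \<in> TMe g n) \<and>
         (\<forall>y \<in> TMe g n. \<forall>t \<in> {0..1}. Phi g n y t = y)"
proof (intro conjI ballI)
  note eqv = equiv_marked_isometric[of g n]
  have flow: "flow t (G, l, p) = (G, interpolated_length G l t, p)"
      "l \<in> extensional (arcs G)" "\<And>e. e \<in> arcs G \<Longrightarrow> 0 < l e"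
      "finite (arcs G)" "\<not> induces_forest G (arcs G)"
    if "(G, l, p) \<in> marked_graphs g n" for G l p t
  proof -
    have G: "G \<in> stable_graphs g" and l: "l \<in> extensional (arcs G)" "\<And>e. e \<in> arcs G \<Longrightarrow> 0 < l e"
      using that by (auto simp: marked_graphs_def PiE_iff)
    note Gp = stable_graphs_props[OF assms G]
    show "flow t (G, l, p) = (G, interpolated_length G l t, p)"
      by (simp add: flow_def flow_length_eq_interpolated_length[OF Gp(4,5) l(2)])
    show "l \<in> extensional (arcs G)" "\<And>e. e \<in> arcs G \<Longrightarrow> 0 < l e"
      "finite (arcs G)" "\<not> induces_forest G (arcs G)" using l Gp by auto
  qed
  show "continuous_map (prod_topology (TMb_topology g n) (top_of_set {0..1})) (TMb_topology g n)
      (\<lambda>(x, t). Phi g n x t)"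
    by (rule continuous_map_Phi[OF assms])
  {
    fix x assume "x \<in> TMb g n"
    then obtain G l p where X: "(G, l, p) \<in> marked_graphs g n"
      and x: "x = marked_isometric g n `` {(G, l, p)}"
      by (auto simp: TMb_def elim: quotientE)
    show "Phi g n x 0 = x"
      unfolding x using Phi_class[OF assms _ X, of 0] flow[OF X] by (simp add: interpolated_length_0)
    have X1: "flow 1 (G, l, p) \<in> marked_graphs g n"
      using flow_in_marked_graphs[OF assms _ X, of 1] by simp
    have Phi: "Phi g n x 1 = marked_isometric g n `` {flow 1 (G, l, p)}"
      unfolding x using Phi_class[OF assms _ X, of 1] by simp
    have "filtered_by_forests G (interpolated_length G l 1)"
      using filtered_interpolated_length_1 flow[OF X] by blast
    then have "filtered_by_forests (fst Y) (fst (snd Y))" if "Y \<in> Phi g n x 1" for Y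
      using marked_isometric_flow(2)[OF assms, of 1 "flow 1 (G, l, p)" Y] that Phi flow(1)[OF X, of 1]
      by simp
    then show "Phi g n x 1 \<in> TMe g n"
      using Phi quotientI[OF X1] by (force simp: TMe_def TMb_def)
  next
    fix y t assume y: "y \<in> TMe g n" and t: "t \<in> {0..1::real}"
    then obtain G l p where X: "(G, l, p) \<in> marked_graphs g n"
      and y_eq: "y = marked_isometric g n `` {(G, l, p)}"
      by (auto simp: TMe_def TMb_def elim: quotientE)
    have "(G, l, p) \<in> y" unfolding y_eq by (rule equiv_class_self[OF eqv X])
    then have "filtered_by_forests G l" using y by (auto simp: TMe_def)
    then have "flow t (G, l, p) = (G, l, p)"
      using flow[OF X] interpolated_length_filtered by metis
    then show "Phi g n y t = y" unfolding y_eq using Phi_class[OF assms t X] by simp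
  }
qed

end
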